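(* Let $\mathrm{char}\,k=0$, let $r\in\mathbb{N}$ and $d=\binom{r+2}{3}$, and let $[I]\in\mathrm{Hilb}^d\mathbb{A}^3$ be Borel-fixed. Then $$\dim_k T_{\mathrm{ppn}}(I)\le\dim_k T_{\mathrm{ppn}}(\mathfrak{m}^r),\qquad \dim_k T_{\mathrm{pnp}}(I)\le\dim_k T_{\mathrm{pnp}}(\mathfrak{m}^r),$$ $$\dim_k T_{\mathrm{nnp}}(I)\le\dim_k T_{\mathrm{nnp}}(\mathfrak{m}^r),\qquad \dim_k T_{\mathrm{npn}}(I)\le\dim_k T_{\mathrm{npn}}(\mathfrak{m}^r).$$ Moreover, in each of the four cases equality occurs if and only if $I=\mathfrak{m}^r$.
   Context: $k$ is an infinite field, $S=k[x,y,z]$, $\mathfrak{m}=(x,y,z)$. $\mathrm{Hilb}^d\mathbb{A}^3$ is the Hilbert scheme of $d$ points in $\mathbb{A}^3=\mathrm{Spec}\,S$; $[I]$ denotes the $k$-point corresponding to an ideal $I\subseteq S$ with $\dim_k(S/I)=d$. Its tangent space at $[I]$ is $T(I)=\mathrm{Hom}_S(I,S/I)$. The point $[I]$ is Borel-fixed if $I$ is stable under the linear coordinate changes given by invertible upper triangular matrices (each variable is sent to a linear combination of itself and the earlier variables in the order $x,y,z$). Borel-fixed ideals are monomial, and in characteristic $0$ a monomial ideal is Borel-fixed if and only if it is strongly stable: writing $x_1=x,x_2=y,x_3=z$, for every monomial $\mathbf{x}^\alpha\in I$ with $\alpha_j>0$ one has $\frac{x_i}{x_j}\mathbf{x}^\alpha\in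 I$ for all $i<j$. For $I$ monomial, $T(I)$ is $\mathbb{Z}^3$-graded: $|T(I)|_\alpha$ denotes the component of degree $\alpha\in\mathbb{Z}^3$, i.e. the $S$-linear maps $I\to S/I$ sending each monomial $\mathbf{x}^\beta\in I$ into the degree $\alpha+\beta$ component of $S/I$. For a non-constant triple $\mathfrak{s}$ of letters from $\{\mathrm{p},\mathrm{n}\}$ (p = "positive or 0", n = "negative") put $T_{\mathfrak{s}}(I)=\bigoplus_{\alpha} |T(I)|_\alpha$, the sum over all $\alpha\in\mathbb{Z}^3$ with $\alpha_i\ge 0$ whenever $\mathfrak{s}_i=\mathrm{p}$ and $\alpha_i<0$ whenever $\mathfrak{s}_i=\mathrm{n}$. *)

theory Defs
  imports
    "Jordan_Normal_Form.VS_Connect"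
    "HOL-Algebra.Ideal_Product"
    "HOL-Algebra.QuotRing"
    "HOL-Library.Poly_Mapping"
    "HOL-Library.Product_Plus"
begin

definition ideal_module :: "'a ring \<Rightarrow> 'a set \<Rightarrow> ('a, 'a) module" where
  "ideal_module R I =
     \<lparr>carrier = I, mult = mult R, one = \<one>\<^bsub>R\<^esub>, zero = \<zero>\<^bsub>R\<^esub>, add = add R,
      smult = mult R\<rparr>"

definition quot_module :: "'a ring \<Rightarrow> 'a set \<Rightarrow> ('a, 'a set) module" where
  "quot_module R I =
     \<lparr>carrier = carrier (R Quot I), mult = mult (R Quot I), one = \<one>\<^bsub>R Quot I\<^esub>,
      zero = \<zero>\<^bsub>R Quot I\<^esub>, add = add (R Quot I),
      smult = (\<lambda>r C. (I +>\<^bsub>R\<^esub> r) \<otimes>\<^bsub>R Quot I\<^esub> C)\<rparr>"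

text \<open>
  Homomorphisms are taken to be extensional on the carrier of the source, so that two of them
  are equal iff they agree there. The ring fields \<open>mult\<close> and \<open>one\<close> of a module record play no
  role in the module axioms; they are filled as in \<open>ring.func_space\<close>.
\<close>

definition hom_module ::
    "'a ring \<Rightarrow> ('a, 'm) module \<Rightarrow> ('a, 'n) module \<Rightarrow> ('a, 'm \<Rightarrow> 'n) module" where
  "hom_module R M N =
     \<lparr>carrier = LinearCombinations.module_hom R M N \<inter> extensional (carrier M),
      mult = (\<lambda>f g. \<lambda>m\<in>carrier M. \<zero>\<^bsub>N\<^esub>),
      one = (\<lambda>m\<in>carrier M. \<zero>\<^bsub>N\<^esub>),
      zero = (\<lambda>m\<in>carrier M. \<zero>\<^bsub>N\<^esub>),
      add = (\<lambda>f g. \<lambda>m\<in>carrier M. f m \<oplus>\<^bsub>N\<^esub> g m),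
      smult = (\<lambda>a f. \<lambda>m\<in>carrier M. a \<odot>\<^bsub>N\<^esub> f m)\<rparr>"

definition restrict_scalars :: "('r \<Rightarrow> 's) \<Rightarrow> ('s, 'm) module \<Rightarrow> ('r, 'm) module" where
  "restrict_scalars f M =
     \<lparr>carrier = carrier M, mult = mult M, one = \<one>\<^bsub>M\<^esub>, zero = \<zero>\<^bsub>M\<^esub>, add = add M,
      smult = (\<lambda>a m. f a \<odot>\<^bsub>M\<^esub> m)\<rparr>"

text \<open>
  \<open>k[x,y,z]\<close> is the monoid algebra of \<open>\<nat>\<^sup>3\<close> over \<open>k\<close>: the monomial with exponent
  \<open>\<beta> = (a, b, c)\<close> is \<open>Poly_Mapping.single \<beta> 1\<close>, and multiplication is convolution.
\<close>

type_synonym 'k poly3 = "(nat \<times> nat \<times> nat) \<Rightarrow>\<^sub>0 'k"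

abbreviation base_field :: "'k::field ring" where
  "base_field \<equiv> class_ring"

abbreviation poly3_ring :: "'k::field poly3 ring" where
  "poly3_ring \<equiv> class_ring"

definition const3 :: "'k::field \<Rightarrow> 'k poly3" where
  "const3 a = Poly_Mapping.single (0, 0, 0) a"

definition monom3 :: "nat \<times> nat \<times> nat \<Rightarrow> 'k::field poly3" where
  "monom3 \<beta> = Poly_Mapping.single \<beta> 1"

definition varX :: "'k::field poly3" where "varX = monom3 (1, 0, 0)"
definition varY :: "'k::field poly3" where "varY = monom3 (0, 1, 0)"
definition varZ :: "'k::field poly3" where "varZ = monom3 (0, 0, 1)"

definition max_ideal :: "'k::field poly3 set" where
  "max_ideal = Idl\<^bsub>poly3_ring\<^esub> {varX, varY, varZ}"

text \<open>Powers are taken in the monoid of ideals under the ideal product; the zeroth power is the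
  whole ring.\<close>

definition max_ideal_power :: "nat \<Rightarrow> 'k::field poly3 set" where
  "max_ideal_power r = max_ideal [^]\<^bsub>ideals_set poly3_ring\<^esub> r"

text \<open>The \<open>k\<close>-algebra endomorphism with \<open>x \<mapsto> f\<close>, \<open>y \<mapsto> g\<close>, \<open>z \<mapsto> h\<close>.\<close>

definition subst3 :: "'k::field poly3 \<Rightarrow> 'k poly3 \<Rightarrow> 'k poly3 \<Rightarrow> 'k poly3 \<Rightarrow> 'k poly3" where
  "subst3 f g h p =
     (\<Sum>(a, b, c)\<in>Poly_Mapping.keys p.
        const3 (Poly_Mapping.lookup p (a, b, c)) * f ^ a * g ^ b * h ^ c)"

definition borel_fixed :: "'k::field poly3 set \<Rightarrow> bool" where
  "borel_fixed I \<longleftrightarrow>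
     (\<forall>a11 a12 a22 a13 a23 a33. a11 \<noteq> 0 \<and> a22 \<noteq> 0 \<and> a33 \<noteq> 0 \<longrightarrow>
        subst3 (const3 a11 * varX)
               (const3 a12 * varX + const3 a22 * varY)
               (const3 a13 * varX + const3 a23 * varY + const3 a33 * varZ) ` I \<subseteq> I)"

text \<open>The \<open>k\<close>-points of \<open>Hilb\<^sup>d \<A>\<^sup>3\<close>. Finiteness is required separately because
  \<open>vectorspace.dim\<close> is unspecified on infinite-dimensional spaces.\<close>

definition hilb_points :: "nat \<Rightarrow> 'k::field poly3 set set" where
  "hilb_points d =
     {I. ideal I poly3_ring \<and>
         vectorspace.fin_dim base_field (restrict_scalars const3 (quot_module poly3_ring I)) \<and>
         vectorspace.dim base_field (restrict_scalars const3 (quot_module poly3_ring I)) = d}"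

definition tangent_space :: "'k::field poly3 set \<Rightarrow> ('k, 'k poly3 \<Rightarrow> 'k poly3 set) module" where
  "tangent_space I =
     restrict_scalars const3
       (hom_module poly3_ring (ideal_module poly3_ring I) (quot_module poly3_ring I))"

fun int3 :: "nat \<times> nat \<times> nat \<Rightarrow> int \<times> int \<times> int" where
  "int3 (a, b, c) = (int a, int b, int c)"

text \<open>For \<open>\<gamma> \<in> \<int>\<^sup>3\<close> with a negative entry the component of \<open>S\<close> of degree \<open>\<gamma>\<close> is
  \<open>{0}\<close>, so the component of \<open>S/I\<close> is its zero element.\<close>

definition poly_component :: "int \<times> int \<times> int \<Rightarrow> 'k::field poly3 set" where
  "poly_component \<gamma> = {p. \<forall>\<delta>\<in>Poly_Mapping.keys p. int3 \<delta> = \<gamma>}"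

definition quot_component :: "'k::field poly3 set \<Rightarrow> int \<times> int \<times> int \<Rightarrow> 'k poly3 set set" where
  "quot_component I \<gamma> = (\<lambda>p. I +>\<^bsub>poly3_ring\<^esub> p) ` poly_component \<gamma>"

definition tangent_component ::
    "'k::field poly3 set \<Rightarrow> int \<times> int \<times> int \<Rightarrow> ('k poly3 \<Rightarrow> 'k poly3 set) set" where
  "tangent_component I \<alpha> =
     {\<phi> \<in> carrier (tangent_space I).
        \<forall>\<beta>. monom3 \<beta> \<in> I \<longrightarrow> \<phi> (monom3 \<beta>) \<in> quot_component I (\<alpha> + int3 \<beta>)}"

datatype letter = Pos | Neg

fun letter_fits :: "letter \<Rightarrow> int \<Rightarrow> bool" where
  "letter_fits Pos a \<longleftrightarrow> a \<ge> 0"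
| "letter_fits Neg a \<longleftrightarrow> a < 0"

fun has_signature :: "letter \<times> letter \<times> letter \<Rightarrow> int \<times> int \<times> int \<Rightarrow> bool" where
  "has_signature (s1, s2, s3) (a1, a2, a3) \<longleftrightarrow>
     letter_fits s1 a1 \<and> letter_fits s2 a2 \<and> letter_fits s3 a3"

text \<open>The direct sum of graded components is formed inside \<open>T(I)\<close>, as the sum of these
  subspaces, i.e. the span of their union.\<close>

definition tangent_signature ::
    "letter \<times> letter \<times> letter \<Rightarrow> 'k::field poly3 set \<Rightarrow> ('k, 'k poly3 \<Rightarrow> 'k poly3 set) module" where
  "tangent_signature s I =
     (tangent_space I)\<lparr>carrier :=
        LinearCombinations.module.span base_field (tangent_space I)
          (\<Union>\<alpha>\<in>{\<alpha>. has_signature s \<alpha>}. tangent_component I \<alpha>)\<rparr>"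

end

theory Submission
  imports Defs
begin

text \<open>
  Let \<open>B\<close> be the set of exponents of the monomials outside the monomial ideal \<open>I\<close>, and call the
  coefficient of \<open>x\<^bsup>\<gamma>\<^esup>\<close> in \<open>\<phi>(x\<^bsup>\<beta>\<^esup>)\<close> an arrow \<open>\<beta> \<rightarrow> \<gamma>\<close> of \<open>\<phi> \<in> T(I)\<close>. Arrows can be translated: if
  \<open>\<gamma> + \<delta> \<in> B\<close> then the arrows \<open>\<beta> \<rightarrow> \<gamma>\<close> and \<open>\<beta> + \<delta> \<rightarrow> \<gamma> + \<delta>\<close> have the same value. For the signature ppn, a
  nonzero arrow with \<open>\<gamma>\<^sub>3\<close> minimal and then \<open>\<gamma>\<^sub>2\<close> maximal satisfies \<open>\<gamma> + e\<^sub>2 \<notin> B\<close> and \<open>\<beta> - e\<^sub>3 \<in> B\<close>, so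
  \<open>\<phi>\<close> is determined by the arrows of this kind, of which there are at most \<open>\<Sum>\<^bsub>\<gamma> \<in> B\<^esub> (\<gamma>\<^sub>1 + 1)\<close>.
  For nnp one takes \<open>\<gamma>\<^sub>2\<close> minimal and then \<open>\<gamma>\<^sub>3\<close> maximal and gets the bound \<open>\<Sum>\<^bsub>\<gamma> \<in> B\<^esub> \<gamma>\<^sub>1\<close>. Exchanging
  \<open>y\<close> and \<open>z\<close> gives the same bounds for pnp and npn, and for \<open>m\<^sup>r\<close> all four bounds are attained by the maps
  sending one monomial of degree \<open>r\<close> to one of degree \<open>r - 1\<close>.

  If \<open>I\<close> is strongly stable and \<open>|B| = (r + 2 choose 3)\<close>, an induction over the slices \<open>\<gamma>\<^sub>1 = i\<close> shows
  that at most \<open>(r - j + 2 choose 3)\<close> elements of \<open>B\<close> have \<open>\<gamma>\<^sub>1 \<ge> j\<close>, and summing over \<open>j\<close> bounds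
  \<open>\<Sum>\<^bsub>\<gamma> \<in> B\<^esub> \<gamma>\<^sub>1\<close> by its value for \<open>m\<^sup>r\<close>. Equality forces \<open>x\<^bsup>r-1\<^esup> \<notin> I\<close>, hence, by stability, no
  monomial of degree \<open>r - 1\<close> lies in \<open>I\<close>, and \<open>I = m\<^sup>r\<close> by counting.
\<close>

section \<open>Strongly stable order ideals\<close>

definition slice_zero :: "(nat \<times> 'a) set \<Rightarrow> 'a set" where
  "slice_zero B = {t. (0, t) \<in> B}"

text \<open>Inductions over slices pass from \<open>B\<close> to this set. The tail type is left
  open so that subsets of N^2 and of N^3 are sliced by the same lemmas.\<close>

definition shift_down :: "(nat \<times> 'a) set \<Rightarrow> (nat \<times> 'a) set" where
  "shift_down B = {(i, t). (Suc i, t) \<in> B}"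

lemma split_slice:
  "B = Pair 0 ` slice_zero B \<union> (\<lambda>(i, t). (Suc i, t)) ` shift_down B" (is "_ = ?L \<union> ?R")
proof
  show "B \<subseteq> ?L \<union> ?R"
  proof
    fix x assume "x \<in> B"
    then obtain i t where x: "x = (i, t)" "(i, t) \<in> B" by (cases x) auto
    show "x \<in> ?L \<union> ?R"
    proof (cases i)
      case 0
      with x show ?thesis by (auto simp: slice_zero_def)
    next
      case (Suc m)
      with x have "(m, t) \<in> shift_down B" by (simp add: shift_down_def)
      then have "(\<lambda>(i, t). (Suc i, t)) (m, t) \<in> ?R" by (rule imageI)
      with x Suc show ?thesis by simp
    qed
  qed
qed (auto simp: slice_zero_def shift_down_def)

lemma finite_slice_zero: "finite B \<Longrightarrow> finite (slice_zero B)"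
  by (rule finite_imageD[of "Pair 0"], rule finite_subset[of _ B])
     (auto simp: slice_zero_def inj_on_def)

lemma finite_shift_down: "finite B \<Longrightarrow> finite (shift_down B)"
  by (rule finite_imageD[of "\<lambda>(i, t). (Suc i, t)"], rule finite_subset[of _ B])
     (auto simp: shift_down_def inj_on_def)

lemma card_slice:
  assumes "finite B"
  shows "card B = card (slice_zero B) + card (shift_down B)"
proof -
  let ?L = "Pair (0::nat) ` slice_zero B" and ?R = "(\<lambda>(i, t). (Suc i, t)) ` shift_down B"
  have "card (?L \<union> ?R) = card ?L + card ?R"
    using finite_slice_zero[OF assms] finite_shift_down[OF assms]
    by (intro card_Un_disjoint) auto
  moreover have "card ?L = card (slice_zero B)" "card ?R = card (shift_down B)"
    by (auto intro!: card_image simp: inj_on_def)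
  ultimately show ?thesis
    by (simp flip: split_slice)
qed

text \<open>Each element outside slice zero loses exactly one from its first coordinate. Iterated,
  this writes the sum as the sum over j >= 1 of the number of elements with first coordinate at
  least j.\<close>

lemma sum_fst_slice:
  assumes "finite B"
  shows "(\<Sum>x\<in>B. fst x) = card (shift_down B) + (\<Sum>x\<in>shift_down B. fst x)"
proof -
  let ?L = "Pair (0::nat) ` slice_zero B" and ?R = "(\<lambda>(i, t). (Suc i, t)) ` shift_down B"
  have "(\<Sum>x\<in>?L \<union> ?R. fst x) = (\<Sum>x\<in>?L. fst x) + (\<Sum>x\<in>?R. fst x)"
    using finite_slice_zero[OF assms] finite_shift_down[OF assms]
    by (intro sum.union_disjoint) auto
  also have "(\<Sum>x\<in>?L. fst x) = 0"
    by (intro sum.neutral) auto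
  also have "(\<Sum>x\<in>?R. fst x) = (\<Sum>x\<in>shift_down B. 1 + fst x)"
    by (subst sum.reindex) (auto simp: inj_on_def split_beta)
  finally show ?thesis unfolding split_slice[symmetric] sum.distrib by simp
qed

text \<open>These closure properties are those of the set of exponents of monomials outside a strongly
  stable ideal, so the exchanges go in the direction opposite to that for the ideal.\<close>

definition borel2 :: "(nat \<times> nat) set \<Rightarrow> bool" where
  "borel2 D \<longleftrightarrow> (\<forall>i j. (Suc i, j) \<in> D \<longrightarrow> (i, Suc j) \<in> D) \<and> (\<forall>i j. (i, Suc j) \<in> D \<longrightarrow> (i, j) \<in> D)"

definition borel3 :: "(nat \<times> nat \<times> nat) set \<Rightarrow> bool" where
  "borel3 B \<longleftrightarrow> (\<forall>i j k. (Suc i, j, k) \<in> B \<longrightarrow> (i, Suc j, k) \<in> B)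
     \<and> (\<forall>i j k. (i, Suc j, k) \<in> B \<longrightarrow> (i, j, Suc k) \<in> B)
     \<and> (\<forall>i j k. (i, j, Suc k) \<in> B \<longrightarrow> (i, j, k) \<in> B)"

lemma borel2D:
  assumes "borel2 D"
  shows "(Suc i, j) \<in> D \<Longrightarrow> (i, Suc j) \<in> D" "(i, Suc j) \<in> D \<Longrightarrow> (i, j) \<in> D"
  using assms unfolding borel2_def by blast+

lemma borel3D:
  assumes "borel3 B"
  shows "(Suc i, j, k) \<in> B \<Longrightarrow> (i, Suc j, k) \<in> B" "(i, Suc j, k) \<in> B \<Longrightarrow> (i, j, Suc k) \<in> B"
    "(i, j, Suc k) \<in> B \<Longrightarrow> (i, j, k) \<in> B"
  using assms unfolding borel3_def by blast+

lemma borel2_slice: "borel3 B \<Longrightarrow> borel2 (slice_zero B)"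
  unfolding borel3_def borel2_def slice_zero_def mem_Collect_eq by blast

lemma borel3_shift: "borel3 B \<Longrightarrow> borel3 (shift_down B)"
  unfolding borel3_def shift_down_def by blast

text \<open>The exchange of x for y moves slice 1 of \<open>B\<close> into slice 0, one step up in
  the y direction; this is why consecutive slices shrink.\<close>

lemma slice_shift_subset: "borel3 B \<Longrightarrow> slice_zero (shift_down B) \<subseteq> shift_down (slice_zero B)"
  unfolding borel3_def shift_down_def slice_zero_def by blast

lemma borel2_antidiag: "borel2 D \<Longrightarrow> (i, j) \<in> D \<Longrightarrow> (0, i + j) \<in> D"
proof (induction i arbitrary: j)
  case (Suc i)
  from Suc.IH[OF Suc.prems(1) borel2D(1)[OF Suc.prems]] show ?case by simp
qed simp

lemma borel2_down: "borel2 D \<Longrightarrow> (i, j) \<in> D \<Longrightarrow> j' \<le> j \<Longrightarrow> (i, j') \<in> D"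
  by (induction j) (auto simp: le_Suc_eq dest: borel2D(2))

lemma borel2_slice_lessThan:
  assumes "borel2 D" "finite D"
  shows "slice_zero D = {..<card (slice_zero D)}"
proof -
  let ?L = "slice_zero D"
  have fin: "finite ?L" using assms(2) by (rule finite_slice_zero)
  have down: "y \<in> ?L" if "x \<in> ?L" "y \<le> x" for x y
    using that borel2_down[OF assms(1)] by (auto simp: slice_zero_def)
  have "\<exists>n. ?L = {..<n}"
  proof (cases "?L = {}")
    case False
    then have "?L = {..<Suc (Max ?L)}"
      unfolding lessThan_Suc_atMost using down[OF Max_in[OF fin False]] Max_ge[OF fin] by blast
    then show ?thesis by blast
  qed auto
  then show ?thesis by (metis card_lessThan)
qed

section \<open>Bounds on the number of elements beyond slice zero\<close>

lemma finite_triangle: "finite {(i, j). i + j < (n::nat)}"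
  by (rule finite_subset[of _ "{..n} \<times> {..n}"]) auto

lemma card_triangle: "card {(i, j). i + j < (n::nat)} = Suc n choose 2"
proof (induction n)
  case (Suc n)
  have "slice_zero {(i, j). i + j < Suc n} = {..<Suc n}"
    "shift_down {(i, j). i + j < Suc n} = {(i, j). i + j < n}"
    by (auto simp: slice_zero_def shift_down_def)
  then have "card {(i, j). i + j < Suc n} = Suc n + (Suc n choose 2)"
    using Suc card_slice[OF finite_triangle[of "Suc n"]] by simp
  then show ?case by (simp add: numeral_2_eq_2)
qed auto

text \<open>Let d be the length of slice zero. If d is at least s, its removal leaves at most (s + 1
  choose 2) - s elements. Otherwise sliding along antidiagonals confines \<open>D\<close> to the
  triangle of side d, and \<open>shift_down D\<close> to that of side d - 1.\<close>

lemma card_shift_down_borel2: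
  assumes D: "borel2 D" "finite D" and le: "card D \<le> Suc s choose 2"
  shows "card (shift_down D) \<le> s choose 2"
proof -
  define d where "d = card (slice_zero D)"
  have card: "card D = d + card (shift_down D)"
    unfolding d_def by (rule card_slice[OF D(2)])
  show ?thesis
  proof (cases "s \<le> d")
    case True
    with card le show ?thesis by (simp add: numeral_2_eq_2)
  next
    case False
    have "(i, j) \<in> shift_down D \<Longrightarrow> Suc (i + j) < d" for i j
      using borel2_antidiag[OF D(1), of "Suc i" j] borel2_slice_lessThan[OF D] 
      by (auto simp: shift_down_def slice_zero_def d_def)
    then have "shift_down D \<subseteq> {(i, j). i + j < d - 1}" by fastforce
    \<comment> \<open>For d = 0 the truncated difference gives 1 choose 2 = 0, and
      \<open>Suc (d - 1)\<close> is still at most \<open>s\<close>, which is positive in this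
      case.\<close>
    then have "card (shift_down D) \<le> Suc (d - 1) choose 2"
      using card_mono[OF finite_triangle] card_triangle by metis
    also have "\<dots> \<le> s choose 2"
      using False by (intro binomial_right_mono) auto
    finally show ?thesis .
  qed
qed

text \<open>Slice 1 fits into the shifted slice 0, which the two-dimensional estimate bounds by the
  next smaller triangular number. So the hypothesis passes to \<open>shift_down B\<close> with
  \<open>r\<close> lowered by one, and Pascal's rule adds up the slices.\<close>

lemma card_le_of_slice_zero:
  assumes "borel3 B" "finite B" "card (slice_zero B) \<le> Suc r choose 2"
  shows "card B \<le> Suc (Suc r) choose 3"
  using assms
proof (induction r arbitrary: B)
  case 0
  then have "slice_zero B = {}"
    using finite_slice_zero[OF \<open>finite B\<close>] by (simp add: binomial_eq_0)
  \<comment> \<open>Repeated exchange of x for y would move any element into the empty slice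
    zero.\<close>
  moreover have "shift_down B = {}"
  proof -
    have "(Suc i, j, k) \<notin> B" for i j k
    proof (induction i arbitrary: j)
      case 0
      show ?case
        using \<open>slice_zero B = {}\<close> borel3D(1)[OF \<open>borel3 B\<close>]
        unfolding slice_zero_def by blast
    next
      case (Suc i)
      then show ?case using borel3D(1)[OF \<open>borel3 B\<close>] by blast
    qed
    then show ?thesis by (auto simp: shift_down_def)
  qed
  ultimately show ?case using card_slice[OF \<open>finite B\<close>] by simp
next
  case (Suc r)
  have "card (slice_zero (shift_down B)) \<le> card (shift_down (slice_zero B))"
    using Suc.prems by (intro card_mono slice_shift_subset finite_shift_down finite_slice_zero)
  also have "\<dots> \<le> Suc r choose 2"
    using Suc.prems by (intro card_shift_down_borel2 borel2_slice finite_slice_zero)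
  finally have "card (shift_down B) \<le> Suc (Suc r) choose 3"
    using Suc.prems by (intro Suc.IH borel3_shift finite_shift_down)
  then show ?case
    using card_slice[OF \<open>finite B\<close>] Suc.prems(3) by (simp add: numeral_3_eq_3 numeral_2_eq_2)
qed

text \<open>The same dichotomy one dimension higher: either slice zero is large and Pascal's rule
  bounds what its removal leaves, or it is small and then the later slices together are
  small.\<close>

lemma card_shift_down_borel3:
  assumes B: "borel3 B" "finite B" and le: "card B \<le> Suc (Suc r) choose 3"
  shows "card (shift_down B) \<le> Suc r choose 3"
proof (cases "Suc r choose 2 \<le> card (slice_zero B)")
  case True
  with card_slice[OF B(2)] le show ?thesis by (simp add: numeral_3_eq_3 numeral_2_eq_2)
next
  case False
  show ?thesis
  proof (cases r)
    case 0
    with le B(2) have "B = {}" by (simp add: binomial_eq_0)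
    then show ?thesis by (simp add: shift_down_def)
  next
    case (Suc m)
    have "card (slice_zero (shift_down B)) \<le> card (shift_down (slice_zero B))"
      using B by (intro card_mono slice_shift_subset finite_shift_down finite_slice_zero)
    also have "\<dots> \<le> r choose 2"
      using False B by (intro card_shift_down_borel2 borel2_slice finite_slice_zero) auto
    finally show ?thesis
      using B card_le_of_slice_zero[of "shift_down B" m] Suc borel3_shift finite_shift_down by auto
  qed
qed

text \<open>To lower y, exchange it for z and lower z; to lower x, exchange it for y and lower
  y.\<close>

lemma borel3_down:
  assumes "borel3 B" "(a, b, c) \<in> B" "a' \<le> a" "b' \<le> b" "c' \<le> c"
  shows "(a', b', c') \<in> B"
proof -
  have z: "(i, j, k) \<in> B \<Longrightarrow> k' \<le> k \<Longrightarrow> (i, j, k') \<in> B" for i j k k'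
    by (induction k) (auto simp: le_Suc_eq dest: borel3D(3)[OF assms(1)])
  have y: "(i, j, k) \<in> B \<Longrightarrow> j' \<le> j \<Longrightarrow> (i, j', k) \<in> B" for i j k j'
  proof (induction j)
    case (Suc j)
    have "(i, j, k) \<in> B" using borel3D(2,3)[OF assms(1)] Suc.prems(1) by blast
    with Suc show ?case by (auto simp: le_Suc_eq)
  qed auto
  have x: "(i, j, k) \<in> B \<Longrightarrow> i' \<le> i \<Longrightarrow> (i', j, k) \<in> B" for i j k i'
  proof (induction i)
    case (Suc i)
    have "(i, j, k) \<in> B" using borel3D(1)[OF assms(1)] Suc.prems(1) y le_SucI by blast
    with Suc show ?case by (auto simp: le_Suc_eq)
  qed auto
  show ?thesis using x y z assms by blast
qed

lemma borel3_simplex: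
  assumes B: "borel3 B" and s: "(s, 0, 0) \<in> B" and le: "a + b + c \<le> s"
  shows "(a, b, c) \<in> B"
proof -
  have x: "(i + n, j, k) \<in> B \<Longrightarrow> (i, n + j, k) \<in> B" for i j k n
  proof (induction n arbitrary: j)
    case (Suc n)
    then have "(i + n, Suc j, k) \<in> B" by (intro borel3D(1)[OF B]) simp
    from Suc.IH[OF this] show ?case by simp
  qed simp
  have y: "(i, j + n, k) \<in> B \<Longrightarrow> (i, j, n + k) \<in> B" for i j k n
  proof (induction n arbitrary: k)
    case (Suc n)
    then have "(i, j + n, Suc k) \<in> B" by (intro borel3D(2)[OF B]) simp
    from Suc.IH[OF this] show ?case by simp
  qed simp
  have "(a + (b + c), 0, 0) \<in> B" using borel3_down[OF B s, of "a + (b + c)" 0 0] le by simp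
  from x[OF this] have "(a, b + c, 0) \<in> B" by simp
  from y[OF this] show ?thesis by simp
qed

section \<open>The simplex, the exponents outside the \<open>r\<close>-th power of the maximal
  ideal, and its extremality\<close>

definition simplex :: "nat \<Rightarrow> (nat \<times> nat \<times> nat) set" where
  "simplex r = {(a, b, c). a + b + c < r}"

lemma simplex_0: "simplex 0 = {}"
  by (auto simp: simplex_def)

lemma finite_simplex: "finite (simplex r)"
  by (rule finite_subset[of _ "{..r} \<times> {..r} \<times> {..r}"]) (auto simp: simplex_def)

lemma slice_simplex: "slice_zero (simplex r) = {(i, j). i + j < r}"
  by (auto simp: simplex_def slice_zero_def)

lemma shift_simplex: "shift_down (simplex (Suc r)) = simplex r"
  by (auto simp: simplex_def shift_down_def)

lemma card_simplex: "card (simplex r) = Suc (Suc r) choose 3"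
proof (induction r)
  case (Suc r)
  then show ?case
    using card_slice[OF finite_simplex[of "Suc r"]]
    by (simp add: slice_simplex shift_simplex card_triangle numeral_3_eq_3 numeral_2_eq_2)
qed (simp add: simplex_0 binomial_eq_0)

lemma sum_fst_simplex: "(\<Sum>x\<in>simplex r. fst x) = Suc (Suc r) choose 4"
proof (induction r)
  case (Suc r)
  then show ?case
    using sum_fst_slice[OF finite_simplex[of "Suc r"]]
    by (simp add: shift_simplex card_simplex eval_nat_numeral)
qed (simp add: simplex_0 binomial_eq_0)

text \<open>By \<open>sum_fst_slice\<close> the sum is a cardinality plus the same sum for
  \<open>shift_down B\<close>. Both are bounded at the next lower \<open>r\<close>, and Pascal's
  rule combines the bounds.\<close>

lemma sum_fst_borel3_le:
  assumes "borel3 B" "finite B" "card B \<le> Suc (Suc r) choose 3"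
  shows "(\<Sum>x\<in>B. fst x) \<le> Suc (Suc r) choose 4"
  using assms
proof (induction r arbitrary: B)
  case 0
  then have "B = {}" by (simp add: binomial_eq_0)
  then show ?case by simp
next
  case (Suc r)
  have "card (shift_down B) \<le> Suc (Suc r) choose 3"
    using Suc.prems by (intro card_shift_down_borel3)
  moreover from this have "(\<Sum>x\<in>shift_down B. fst x) \<le> Suc (Suc r) choose 4"
    using Suc.prems by (intro Suc.IH borel3_shift finite_shift_down)
  ultimately show ?case
    using sum_fst_slice[OF \<open>finite B\<close>] by (simp add: eval_nat_numeral)
qed

text \<open>The parameter is shifted by one so that the smallest case is a single point. Equality of
  the total forces equality in both summands, so extremality descends to
  \<open>shift_down B\<close>, and after \<open>r\<close> steps a nonempty set remains.\<close>

lemma sum_fst_borel3_eq: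
  assumes "borel3 B" "finite B" "card B = Suc (Suc (Suc r)) choose 3"
    and "(\<Sum>x\<in>B. fst x) = Suc (Suc (Suc r)) choose 4"
  shows "(r, 0, 0) \<in> B"
  using assms
proof (induction r arbitrary: B)
  case 0
  then have "B \<noteq> {}" by auto
  then obtain a b c where "(a, b, c) \<in> B" by auto
  then show ?case using borel3_down[OF \<open>borel3 B\<close>, of a b c 0 0 0] by simp
next
  case (Suc r)
  let ?B = "shift_down B"
  have B: "borel3 ?B" "finite ?B"
    using Suc.prems by (auto intro: borel3_shift finite_shift_down)
  have le: "card ?B \<le> Suc (Suc (Suc r)) choose 3"
    using Suc.prems by (intro card_shift_down_borel3) auto
  from sum_fst_borel3_le[OF B le] le sum_fst_slice[OF \<open>finite B\<close>] Suc.prems(4)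
  have "card ?B = Suc (Suc (Suc r)) choose 3" "(\<Sum>x\<in>?B. fst x) = Suc (Suc (Suc r)) choose 4"
    by (simp_all add: eval_nat_numeral)
  from Suc.IH[OF B this] show ?case by (simp add: shift_down_def)
qed

lemma sum_fst_borel3:
  assumes B: "borel3 B" "finite B" and card: "card B = card (simplex r)"
  shows "(\<Sum>x\<in>B. fst x) \<le> (\<Sum>x\<in>simplex r. fst x)"
    and "(\<Sum>x\<in>B. fst x) = (\<Sum>x\<in>simplex r. fst x) \<Longrightarrow> B = simplex r"
proof -
  show "(\<Sum>x\<in>B. fst x) \<le> (\<Sum>x\<in>simplex r. fst x)"
    using sum_fst_borel3_le[OF B] card by (simp add: card_simplex sum_fst_simplex)
next
  assume eq: "(\<Sum>x\<in>B. fst x) = (\<Sum>x\<in>simplex r. fst x)"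
  show "B = simplex r"
  proof (cases r)
    case 0
    then show ?thesis using card B by (simp add: simplex_0)
  next
    case (Suc m)
    then have "(m, 0, 0) \<in> B"
      using sum_fst_borel3_eq[OF B] card eq by (simp add: card_simplex sum_fst_simplex)
    then have "simplex r \<subseteq> B"
      using borel3_simplex[OF B(1)] Suc by (auto simp: simplex_def)
    then show ?thesis using card_subset_eq[OF B(2)] card by metis
  qed
qed

section \<open>Counting the extremal arrows\<close>

text \<open>A pair in \<open>E\<close> is determined by \<open>(g\<^sub>1, b\<^sub>2, g\<^sub>3)\<close> and \<open>b\<^sub>1\<close>: \<open>g\<^sub>2\<close> is maximal on its line in \<open>B\<close>
  and \<open>b\<^sub>3\<close> is minimal on its line outside \<open>B\<close>.\<close>

lemma card_arrows_ppn:
  fixes B :: "(nat \<times> nat \<times> nat) set"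
  assumes fin: "finite B"
    and down: "\<And>a b c a' b' c'. (a, b, c) \<in> B \<Longrightarrow> a' \<le> a \<Longrightarrow> b' \<le> b \<Longrightarrow> c' \<le> c \<Longrightarrow> (a', b', c') \<in> B"
  defines "E \<equiv> {((b1, b2, b3), (g1, g2, g3)). (g1, g2, g3) \<in> B \<and> (g1, Suc g2, g3) \<notin> B
       \<and> (b1, b2, b3) \<notin> B \<and> (b1, b2, b3 - 1) \<in> B \<and> b1 \<le> g1 \<and> b2 \<le> g2 \<and> g3 < b3}"
  shows "finite E" and "card E \<le> (\<Sum>x\<in>B. Suc (fst x))"
proof -
  let ?f = "\<lambda>((b1, b2, b3), (g1, g2, g3)). ((g1, b2, g3), b1)"
  let ?S = "SIGMA x:B. {..fst x}"
  have pred: "x < y \<Longrightarrow> x \<le> y - 1" for x y :: nat by simp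
  have inj: "inj_on ?f E"
  proof (rule inj_onI)
    fix p q assume p: "p \<in> E" and q: "q \<in> E" and eq: "?f p = ?f q"
    obtain b1 b2 b3 g1 g2 g3 where p': "p = ((b1, b2, b3), (g1, g2, g3))"
      by (cases p) auto
    with eq obtain b3' g2' where q': "q = ((b1, b2, b3'), (g1, g2', g3))"
      by (cases q) auto
    \<comment> \<open>If b3 < b3', then (b1, b2, b3) lies below (b1, b2, b3' - 1), an element of
      \<open>B\<close>, although it is outside \<open>B\<close>. The other three comparisons are
      alike.\<close>
    have "\<not> b3 < b3'"
      using p q down[of b1 b2 "b3' - 1" b1 b2 b3, OF _ le_refl le_refl pred] by (auto simp: p' q' E_def)
    moreover have "\<not> b3' < b3"
      using p q down[of b1 b2 "b3 - 1" b1 b2 b3', OF _ le_refl le_refl pred] by (auto simp: p' q' E_def)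
    moreover have "\<not> g2 < g2'"
      using p q down[of g1 g2' g3 g1 "Suc g2" g3, OF _ le_refl Suc_leI le_refl] by (auto simp: p' q' E_def)
    moreover have "\<not> g2' < g2"
      using p q down[of g1 g2 g3 g1 "Suc g2'" g3, OF _ le_refl Suc_leI le_refl] by (auto simp: p' q' E_def)
    ultimately show "p = q" by (simp add: p' q')
  qed
  have sub: "?f ` E \<subseteq> ?S"
    using down by (fastforce simp: E_def)
  have S: "finite ?S" using fin by auto
  show "finite E" using inj sub S by (meson finite_imageD finite_subset)
  have "card E \<le> card ?S" using card_inj_on_le[OF inj sub S] .
  also have "\<dots> = (\<Sum>x\<in>B. Suc (fst x))" using fin by (subst card_SigmaI) auto
  finally show "card E \<le> (\<Sum>x\<in>B. Suc (fst x))" .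
qed

text \<open>Here (b1, g2, b3) and g1 determine the pair: g3 is maximal on its line in
  \<open>B\<close> and b2 minimal on its line outside \<open>B\<close>. As g2 < b2, the triple lies
  below (b1, b2 - 1, b3) and hence in \<open>B\<close>, and g1 < b1 leaves b1 choices for
  g1.\<close>

lemma card_arrows_nnp:
  fixes B :: "(nat \<times> nat \<times> nat) set"
  assumes fin: "finite B"
    and down: "\<And>a b c a' b' c'. (a, b, c) \<in> B \<Longrightarrow> a' \<le> a \<Longrightarrow> b' \<le> b \<Longrightarrow> c' \<le> c \<Longrightarrow> (a', b', c') \<in> B"
  defines "E \<equiv> {((b1, b2, b3), (g1, g2, g3)). (g1, g2, g3) \<in> B \<and> (g1, g2, Suc g3) \<notin> B
       \<and> (b1, b2, b3) \<notin> B \<and> (b1, b2 - 1, b3) \<in> B \<and> g1 < b1 \<and> g2 < b2 \<and> b3 \<le> g3}"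
  shows "finite E" and "card E \<le> (\<Sum>x\<in>B. fst x)"
proof -
  let ?f = "\<lambda>((b1, b2, b3), (g1, g2, g3)). ((b1, g2, b3), g1)"
  let ?S = "SIGMA x:B. {..<fst x}"
  have pred: "x < y \<Longrightarrow> x \<le> y - 1" for x y :: nat by simp
  have inj: "inj_on ?f E"
  proof (rule inj_onI)
    fix p q assume p: "p \<in> E" and q: "q \<in> E" and eq: "?f p = ?f q"
    obtain b1 b2 b3 g1 g2 g3 where p': "p = ((b1, b2, b3), (g1, g2, g3))"
      by (cases p) auto
    with eq obtain b2' g3' where q': "q = ((b1, b2', b3), (g1, g2, g3'))"
      by (cases q) auto
    have "\<not> b2 < b2'"
      using p q down[of b1 "b2' - 1" b3 b1 b2 b3, OF _ le_refl pred le_refl] by (auto simp: p' q' E_def)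
    moreover have "\<not> b2' < b2"
      using p q down[of b1 "b2 - 1" b3 b1 b2' b3, OF _ le_refl pred le_refl] by (auto simp: p' q' E_def)
    moreover have "\<not> g3 < g3'"
      using p q down[of g1 g2 g3' g1 g2 "Suc g3", OF _ le_refl le_refl Suc_leI] by (auto simp: p' q' E_def)
    moreover have "\<not> g3' < g3"
      using p q down[of g1 g2 g3 g1 g2 "Suc g3'", OF _ le_refl le_refl Suc_leI] by (auto simp: p' q' E_def)
    ultimately show "p = q" by (simp add: p' q')
  qed
  have sub: "?f ` E \<subseteq> ?S"
  proof
    fix y assume "y \<in> ?f ` E"
    then obtain b1 b2 b3 g1 g2 g3 where y: "y = ((b1, g2, b3), g1)"
      and "((b1, b2, b3), (g1, g2, g3)) \<in> E" by auto
    then have "(b1, b2 - 1, b3) \<in> B" "g1 < b1" "g2 \<le> b2 - 1" by (auto simp: E_def)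
    then show "y \<in> ?S" using down[of b1 "b2 - 1" b3 b1 g2 b3] y by auto
  qed
  have S: "finite ?S" using fin by auto
  show "finite E" using inj sub S by (meson finite_imageD finite_subset)
  have "card E \<le> card ?S" using card_inj_on_le[OF inj sub S] .
  also have "\<dots> = (\<Sum>x\<in>B. fst x)" using fin by (subst card_SigmaI) auto
  finally show "card E \<le> (\<Sum>x\<in>B. fst x)" .
qed

text \<open>The map inverts the encoding by (g1, b2, g3) and b1: in degrees r and r - 1 the missing
  coordinates b3 and g2 are forced by the degree.\<close>

lemma card_simplex_arrows_ppn:
  "(\<Sum>x\<in>simplex r. Suc (fst x)) \<le> card {((b1, b2, b3), (g1, g2, g3)).
      b1 + b2 + b3 = r \<and> Suc (g1 + g2 + g3) = r \<and> b1 \<le> g1 \<and> b2 \<le> g2 \<and> g3 < (b3::nat)}"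
    (is "_ \<le> card ?E")
proof -
  let ?S = "SIGMA x:simplex r. {..fst x}"
  let ?f = "\<lambda>((a, b, c), u). ((u, b, r - u - b), (a, r - 1 - a - c, c))"
  have "(\<Sum>x\<in>simplex r. Suc (fst x)) = card ?S"
    using finite_simplex by (subst card_SigmaI) auto
  also have "\<dots> \<le> card ?E"
  proof (rule card_inj_on_le)
    show "inj_on ?f ?S" by (auto simp: inj_on_def)
    show "?f ` ?S \<subseteq> ?E" by (auto simp: simplex_def)
    show "finite ?E"
      by (rule finite_subset[of _ "({..r} \<times> {..r} \<times> {..r}) \<times> ({..r} \<times> {..r} \<times> {..r})"]) auto
  qed
  finally show ?thesis .
qed

text \<open>As for ppn, with b2 and g3 as the coordinates recovered from the degrees.\<close>

lemma card_simplex_arrows_nnp: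
  "(\<Sum>x\<in>simplex r. fst x) \<le> card {((b1, b2, b3), (g1, g2, g3)).
      b1 + b2 + b3 = r \<and> Suc (g1 + g2 + g3) = r \<and> g1 < b1 \<and> g2 < b2 \<and> b3 \<le> (g3::nat)}"
    (is "_ \<le> card ?E")
proof -
  let ?S = "SIGMA x:simplex r. {..<fst x}"
  let ?f = "\<lambda>((a, b, c), u). ((a, r - a - c, c), (u, b, r - 1 - u - b))"
  have "(\<Sum>x\<in>simplex r. fst x) = card ?S"
    using finite_simplex by (subst card_SigmaI) auto
  also have "\<dots> \<le> card ?E"
  proof (rule card_inj_on_le)
    show "inj_on ?f ?S" by (auto simp: inj_on_def)
    show "?f ` ?S \<subseteq> ?E" by (auto simp: simplex_def)
    show "finite ?E"
      by (rule finite_subset[of _ "({..r} \<times> {..r} \<times> {..r}) \<times> ({..r} \<times> {..r} \<times> {..r})"]) auto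
  qed
  finally show ?thesis .
qed

section \<open>Dimension bounds from linear forms\<close>

definition linear_form :: "('k::field, 'v, 'z) module_scheme \<Rightarrow> ('v \<Rightarrow> 'k) \<Rightarrow> bool" where
  "linear_form V f \<longleftrightarrow>
     (\<forall>x\<in>carrier V. \<forall>y\<in>carrier V. f (x \<oplus>\<^bsub>V\<^esub> y) = f x + f y) \<and>
     (\<forall>c. \<forall>x\<in>carrier V. f (c \<odot>\<^bsub>V\<^esub> x) = c * f x)"

lemma linear_formD:
  assumes "linear_form V f"
  shows "x \<in> carrier V \<Longrightarrow> y \<in> carrier V \<Longrightarrow> f (x \<oplus>\<^bsub>V\<^esub> y) = f x + f y"
    and "x \<in> carrier V \<Longrightarrow> f (c \<odot>\<^bsub>V\<^esub> x) = c * f x"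
  using assms by (auto simp: linear_form_def)

locale class_vectorspace = vectorspace "class_ring :: 'k::field ring" V for V (structure)
begin

lemma form_zero: "linear_form V f \<Longrightarrow> f \<zero>\<^bsub>V\<^esub> = 0"
  using linear_formD(1)[of V f "\<zero>\<^bsub>V\<^esub>" "\<zero>\<^bsub>V\<^esub>"] add_left_cancel[of "f \<zero>\<^bsub>V\<^esub>" "f \<zero>\<^bsub>V\<^esub>" 0]
  by simp

lemma smult_closed': "x \<in> carrier V \<Longrightarrow> c \<odot>\<^bsub>V\<^esub> x \<in> carrier V" for c :: 'k
  by (intro smult_closed) (auto simp: class_ring_simps)

lemma form_finsum:
  assumes "linear_form V f" "g \<in> A \<rightarrow> carrier V"
  shows "f (finsum V g A) = (\<Sum>x\<in>A. f (g x))"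
  using assms(2)
proof (induction A rule: infinite_finite_induct)
  case (insert x A)
  then show ?case
    by (simp add: linear_formD(1)[OF assms(1)] Pi_iff)
qed (auto simp: form_zero[OF assms(1)])

lemma form_lincomb:
  assumes "linear_form V f" "A \<subseteq> carrier V"
  shows "f (lincomb a A) = (\<Sum>x\<in>A. a x * f x)"
  unfolding lincomb_def using assms
  by (subst form_finsum) (auto intro!: smult_closed' sum.cong simp: linear_formD(2))

lemma submodule_kernel:
  assumes "\<And>e. e \<in> E \<Longrightarrow> linear_form V (f e)"
  shows "submodule class_ring {v \<in> carrier V. \<forall>e\<in>E. f e v = 0} V"
  using assms module_axioms
  by unfold_locales (auto simp: form_zero linear_formD smult_closed' class_ring_simps)

text \<open>Gaussian elimination on the values of the forms, adding at most one vector per form. The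
  dimension may be infinite at this point; its finiteness is deduced from this lemma.\<close>

lemma exists_interpolating_set:
  assumes "finite E" "\<And>e. e \<in> E \<Longrightarrow> linear_form V (f e)"
  shows "\<exists>A. finite A \<and> A \<subseteq> carrier V \<and> card A \<le> card E
           \<and> (\<forall>v\<in>carrier V. \<exists>w\<in>span A. \<forall>e\<in>E. f e v = f e w)"
  using assms
proof (induction E)
  case empty
  then show ?case
    by (intro exI[of _ "{}"]) (auto simp: span_empty)
next
  case (insert e E)
  from insert.IH[OF insert.prems[OF insertI2]]
  obtain A where A: "finite A" "A \<subseteq> carrier V" "card A \<le> card E"
    and interp: "\<And>v. v \<in> carrier V \<Longrightarrow> \<exists>w\<in>span A. \<forall>e\<in>E. f e v = f e w"
    by blast
  note form = linear_formD[OF insert.prems]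
  have span_A: "w \<in> carrier V" if "w \<in> span A" for w
    using that span_closed A(2) by blast
  show ?case
  proof (cases "\<exists>u\<in>carrier V. (\<forall>e\<in>E. f e u = 0) \<and> f e u \<noteq> 0")
    \<comment> \<open>A vector u killed by the earlier forms but not by \<open>f e\<close> corrects
      the value of \<open>f e\<close> without disturbing the others.\<close>
    case True
    then obtain u where u: "u \<in> carrier V" "\<forall>e\<in>E. f e u = 0" "f e u \<noteq> 0" by blast
    show ?thesis
    proof (intro exI[of _ "insert u A"] conjI ballI)
      show "card (insert u A) \<le> card (insert e E)"
        using A insert.hyps by (simp add: card_insert_if)
      fix v assume v: "v \<in> carrier V"
      then obtain w where w: "w \<in> span A" "\<forall>e\<in>E. f e v = f e w" using interp by blast
      define w' where "w' = w \<oplus>\<^bsub>V\<^esub> ((f e v - f e w) / f e u) \<odot>\<^bsub>V\<^esub> u"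
      have sub: "insert u A \<subseteq> carrier V" using A(2) u(1) by blast
      have "u \<in> span (insert u A)" using in_own_span[OF sub] by blast
      moreover have "w \<in> span (insert u A)" using w(1) span_is_monotone[of A "insert u A"] by blast
      ultimately have "w' \<in> span (insert u A)"
        unfolding w'_def
        by (intro span_add1[OF sub] submodule.smult_closed[OF span_is_submodule[OF sub]])
           (auto simp: class_ring_simps)
      moreover have "\<forall>e'\<in>insert e E. f e' v = f e' w'"
        using u w(2) span_A[OF w(1)] by (auto simp: w'_def form smult_closed')
      ultimately show "\<exists>w\<in>span (insert u A). \<forall>e'\<in>insert e E. f e' v = f e' w" by blast
    qed (use A u in auto)
  next
    \<comment> \<open>Now \<open>f e\<close> vanishes wherever all earlier forms do, so agreement
      under those carries over to \<open>f e\<close>.\<close>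
    case False
    show ?thesis
    proof (intro exI[of _ A] conjI ballI)
      fix v assume v: "v \<in> carrier V"
      then obtain w where w: "w \<in> span A" "\<forall>e\<in>E. f e v = f e w" using interp by blast
      note w' = span_A[OF w(1)]
      define u where "u = v \<oplus>\<^bsub>V\<^esub> (- 1) \<odot>\<^bsub>V\<^esub> w"
      have u: "f e' u = f e' v - f e' w" if "e' \<in> insert e E" for e'
        using that v w' by (simp add: u_def form smult_closed' del: insert_iff)
      have "u \<in> carrier V" using v w' by (simp add: u_def smult_closed')
      moreover have "\<forall>e\<in>E. f e u = 0" using u w(2) by simp
      ultimately have "f e u = 0" using False by blast
      then show "\<exists>w\<in>span A. \<forall>e'\<in>insert e E. f e' v = f e' w"
        using u[of e] w by auto
    qed (use A insert.hyps in auto)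
  qed
qed

text \<open>A combination that agrees with v under all forms of a separating family equals v, so the
  interpolating set generates.\<close>

lemma dim_le_card_separating:
  assumes E: "finite E" and form: "\<And>e. e \<in> E \<Longrightarrow> linear_form V (f e)"
    and sep: "\<And>v. v \<in> carrier V \<Longrightarrow> (\<And>e. e \<in> E \<Longrightarrow> f e v = 0) \<Longrightarrow> v = \<zero>\<^bsub>V\<^esub>"
  shows "fin_dim" "dim \<le> card E"
proof -
  obtain A where A: "finite A" "A \<subseteq> carrier V" "card A \<le> card E"
    and interp: "\<And>v. v \<in> carrier V \<Longrightarrow> \<exists>w\<in>span A. \<forall>e\<in>E. f e v = f e w"
    using exists_interpolating_set[of E f, OF E form] by blast
  have "v \<in> span A" if v: "v \<in> carrier V" for v
  proof -
    obtain w where w: "w \<in> span A" "\<forall>e\<in>E. f e v = f e w" using interp v by blast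
    then have w': "w \<in> carrier V" using span_closed A(2) by blast
    have "v \<oplus>\<^bsub>V\<^esub> (- 1) \<odot>\<^bsub>V\<^esub> w = \<zero>\<^bsub>V\<^esub>"
      using v w w' by (intro sep) (auto simp: linear_formD[OF form] smult_closed')
    moreover have "(- 1) \<odot>\<^bsub>V\<^esub> w = \<ominus>\<^bsub>V\<^esub> w"
      using smult_minus_1[OF w'] by (simp add: class_ring_simps)
    ultimately have "v = w"
      using v w' M.minus_equality M.minus_minus by (metis M.a_inv_closed)
    with w show ?thesis by simp
  qed
  then have gen: "gen_set A" using span_closed A(2) by blast
  then show "fin_dim" using A unfolding fin_dim_def by blast
  show "dim \<le> card E" using gen_ge_dim[OF A(1,2) gen] A(3) by simp
qed

text \<open>Applying \<open>f e\<close> to a linear relation among the vectors isolates the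
  coefficient of \<open>v e\<close>.\<close>

lemma card_le_dim_dual:
  assumes E: "finite E" and fin: "fin_dim"
    and form: "\<And>e. e \<in> E \<Longrightarrow> linear_form V (f e)"
    and v: "\<And>e. e \<in> E \<Longrightarrow> v e \<in> carrier V"
    and dual: "\<And>e e'. e \<in> E \<Longrightarrow> e' \<in> E \<Longrightarrow> f e (v e') = (if e = e' then 1 else 0)"
  shows "card E \<le> dim"
proof -
  have inj: "inj_on v E"
    using dual by (intro inj_onI) (metis zero_neq_one)
  have sub: "v ` E \<subseteq> carrier V" using v by blast
  have "lin_indpt (v ` E)"
  proof (rule finite_lin_indpt2)
    fix a assume "lincomb a (v ` E) = \<zero>\<^bsub>V\<^esub>"
    show "\<forall>x\<in>v ` E. a x = \<zero>\<^bsub>class_ring\<^esub>"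
    proof safe
      fix e assume e: "e \<in> E"
      have "0 = (\<Sum>x\<in>v ` E. a x * f e x)"
        using form_lincomb[OF form[OF e] sub, of a] form_zero[OF form[OF e]]
          \<open>lincomb a (v ` E) = \<zero>\<^bsub>V\<^esub>\<close> by simp
      also have "\<dots> = (\<Sum>e'\<in>E. a (v e') * f e (v e'))"
        by (subst sum.reindex[OF inj]) simp
      also have "\<dots> = (\<Sum>e'\<in>E. if e = e' then a (v e') else 0)"
        using dual[OF e] by (intro sum.cong) auto
      finally show "a (v e) = \<zero>\<^bsub>class_ring\<^esub>" using E e by (simp add: class_ring_simps)
    qed
  qed (use E sub in auto)
  from li_le_dim(2)[OF fin sub this] show ?thesis by (simp add: card_image[OF inj])
qed

end

section \<open>Modules of homomorphisms\<close>

lemma module_ideal_module: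
  assumes "cring R" "ideal I R"
  shows "module R (ideal_module R I)"
proof -
  interpret cring R by fact
  interpret I: ideal I R by fact
  show ?thesis
  proof (rule moduleI)
    show "abelian_group (ideal_module R I)"
    proof (rule abelian_groupI)
      fix x assume "x \<in> carrier (ideal_module R I)"
      then show "\<exists>y\<in>carrier (ideal_module R I). y \<oplus>\<^bsub>ideal_module R I\<^esub> x = \<zero>\<^bsub>ideal_module R I\<^esub>"
        by (intro bexI[of _ "\<ominus>\<^bsub>R\<^esub> x"]) (auto simp: ideal_module_def I.Icarr l_neg)
    next
      fix x y z assume "x \<in> carrier (ideal_module R I)" "y \<in> carrier (ideal_module R I)"
        "z \<in> carrier (ideal_module R I)"
      then show "x \<oplus>\<^bsub>ideal_module R I\<^esub> y \<oplus>\<^bsub>ideal_module R I\<^esub> z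
          = x \<oplus>\<^bsub>ideal_module R I\<^esub> (y \<oplus>\<^bsub>ideal_module R I\<^esub> z)"
        by (simp add: ideal_module_def I.Icarr a_assoc)
    next
      fix x y assume "x \<in> carrier (ideal_module R I)" "y \<in> carrier (ideal_module R I)"
      then show "x \<oplus>\<^bsub>ideal_module R I\<^esub> y = y \<oplus>\<^bsub>ideal_module R I\<^esub> x"
        by (simp add: ideal_module_def I.Icarr a_comm)
    qed (simp_all add: ideal_module_def I.Icarr)
  qed (simp_all add: ideal_module_def I.Icarr I.I_l_closed l_distr r_distr m_assoc is_cring)
qed

lemma module_quot_module:
  assumes "cring R" "ideal I R"
  shows "module R (quot_module R I)"
proof -
  interpret cring R by fact
  interpret I: ideal I R by fact
  interpret Q: cring "R Quot I" by (rule I.quotient_is_cring) fact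
  have hom: "(+>\<^bsub>R\<^esub>) I \<in> Ring.ring_hom R (R Quot I)"
    by (rule I.rcos_ring_hom)
  show ?thesis
  proof (rule moduleI)
    show "abelian_group (quot_module R I)"
    proof (rule abelian_groupI)
      fix x assume "x \<in> carrier (quot_module R I)"
      then show "\<exists>y\<in>carrier (quot_module R I). y \<oplus>\<^bsub>quot_module R I\<^esub> x = \<zero>\<^bsub>quot_module R I\<^esub>"
        by (intro bexI[of _ "\<ominus>\<^bsub>R Quot I\<^esub> x"]) (auto simp: quot_module_def Q.l_neg)
    qed (simp_all add: quot_module_def Q.a_ac)
  qed (simp_all add: quot_module_def is_cring ring_hom_closed[OF hom] ring_hom_add[OF hom]
      ring_hom_mult[OF hom] ring_hom_one[OF hom] Q.l_distr Q.r_distr Q.m_assoc)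
qed

lemma module_hom_module:
  assumes "module R M" "module R N"
  shows "module R (hom_module R M N)"
proof -
  interpret M: Module.module R M by fact
  interpret N: Module.module R N by fact
  let ?H = "hom_module R M N"
  let ?S = "LinearCombinations.module_hom R M N"
  have carrier: "f \<in> carrier ?H \<longleftrightarrow> f \<in> ?S \<and> f \<in> extensional (carrier M)" for f
    by (simp add: hom_module_def)
  have closed: "f \<in> carrier ?H \<Longrightarrow> x \<in> carrier M \<Longrightarrow> f x \<in> carrier N" for f x
    by (auto simp: carrier LinearCombinations.module_hom_def)
  have hom: "f \<in> carrier ?H \<Longrightarrow> x \<in> carrier M \<Longrightarrow> y \<in> carrier M \<Longrightarrow> f (x \<oplus>\<^bsub>M\<^esub> y) = f x \<oplus>\<^bsub>N\<^esub> f y"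
    "f \<in> carrier ?H \<Longrightarrow> a \<in> carrier R \<Longrightarrow> x \<in> carrier M \<Longrightarrow> f (a \<odot>\<^bsub>M\<^esub> x) = a \<odot>\<^bsub>N\<^esub> f x"
    for f x y a
    by (auto simp: carrier LinearCombinations.module_hom_def)
  have ext: "f \<in> carrier ?H \<Longrightarrow> g \<in> carrier ?H \<Longrightarrow> (\<And>x. x \<in> carrier M \<Longrightarrow> f x = g x) \<Longrightarrow> f = g"
    for f g by (auto simp: carrier intro: extensionalityI)
  have restrict: "(\<lambda>x\<in>carrier M. h x) \<in> carrier ?H"
    if "\<And>x. x \<in> carrier M \<Longrightarrow> h x \<in> carrier N"
      and "\<And>x y. x \<in> carrier M \<Longrightarrow> y \<in> carrier M \<Longrightarrow> h (x \<oplus>\<^bsub>M\<^esub> y) = h x \<oplus>\<^bsub>N\<^esub> h y"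
      and "\<And>a x. a \<in> carrier R \<Longrightarrow> x \<in> carrier M \<Longrightarrow> h (a \<odot>\<^bsub>M\<^esub> x) = a \<odot>\<^bsub>N\<^esub> h x" for h
    using that by (auto simp: hom_module_def LinearCombinations.module_hom_def)
  have zero: "\<zero>\<^bsub>?H\<^esub> = (\<lambda>x\<in>carrier M. \<zero>\<^bsub>N\<^esub>)"
    and add: "f \<oplus>\<^bsub>?H\<^esub> g = (\<lambda>x\<in>carrier M. f x \<oplus>\<^bsub>N\<^esub> g x)"
    and smult: "a \<odot>\<^bsub>?H\<^esub> f = (\<lambda>x\<in>carrier M. a \<odot>\<^bsub>N\<^esub> f x)" for f g a
    by (auto simp: hom_module_def)
  have zero_closed: "\<zero>\<^bsub>?H\<^esub> \<in> carrier ?H"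
    unfolding zero by (rule restrict) auto
  have add_closed: "f \<oplus>\<^bsub>?H\<^esub> g \<in> carrier ?H" if "f \<in> carrier ?H" "g \<in> carrier ?H" for f g
    unfolding add
  proof (rule restrict)
    fix x y assume "x \<in> carrier M" "y \<in> carrier M"
    with that show "f (x \<oplus>\<^bsub>M\<^esub> y) \<oplus>\<^bsub>N\<^esub> g (x \<oplus>\<^bsub>M\<^esub> y) = f x \<oplus>\<^bsub>N\<^esub> g x \<oplus>\<^bsub>N\<^esub> (f y \<oplus>\<^bsub>N\<^esub> g y)"
      using closed[OF that(1)] closed[OF that(2)] by (simp add: hom N.a_ac)
  qed (use that closed in \<open>auto simp: hom N.smult_r_distr\<close>)
  have smult_closed: "a \<odot>\<^bsub>?H\<^esub> f \<in> carrier ?H" if "a \<in> carrier R" "f \<in> carrier ?H" for a f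
    unfolding smult
  proof (rule restrict)
    \<comment> \<open>Commutativity of \<open>R\<close> makes a scalar multiple of a homomorphism
      linear again.\<close>
    fix b x assume "b \<in> carrier R" "x \<in> carrier M"
    with that show "a \<odot>\<^bsub>N\<^esub> f (b \<odot>\<^bsub>M\<^esub> x) = b \<odot>\<^bsub>N\<^esub> (a \<odot>\<^bsub>N\<^esub> f x)"
      using closed[OF that(2)] by (simp add: hom M.m_comm flip: N.smult_assoc1)
  qed (use that closed in \<open>auto simp: hom N.smult_r_distr\<close>)
  have "abelian_group ?H"
  proof (rule abelian_groupI)
    fix f assume f: "f \<in> carrier ?H"
    \<comment> \<open>The inverse of f is its multiple by -1, whose membership is already
      known.\<close>
    show "\<exists>g\<in>carrier ?H. g \<oplus>\<^bsub>?H\<^esub> f = \<zero>\<^bsub>?H\<^esub>"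
    proof (rule bexI)
      show "(\<ominus>\<^bsub>R\<^esub> \<one>\<^bsub>R\<^esub>) \<odot>\<^bsub>?H\<^esub> f \<in> carrier ?H" using f by (intro smult_closed) auto
      then show "(\<ominus>\<^bsub>R\<^esub> \<one>\<^bsub>R\<^esub>) \<odot>\<^bsub>?H\<^esub> f \<oplus>\<^bsub>?H\<^esub> f = \<zero>\<^bsub>?H\<^esub>"
        using f closed[OF f]
        by (intro ext add_closed zero_closed)
           (auto simp: zero add smult N.smult_minus_1 N.l_neg)
    qed
  next
    fix f g h assume "f \<in> carrier ?H" "g \<in> carrier ?H" "h \<in> carrier ?H"
    then show "f \<oplus>\<^bsub>?H\<^esub> g \<oplus>\<^bsub>?H\<^esub> h = f \<oplus>\<^bsub>?H\<^esub> (g \<oplus>\<^bsub>?H\<^esub> h)"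
      by (intro ext add_closed) (auto simp: add closed N.a_assoc)
  next
    fix f g assume "f \<in> carrier ?H" "g \<in> carrier ?H"
    then show "f \<oplus>\<^bsub>?H\<^esub> g = g \<oplus>\<^bsub>?H\<^esub> f"
      by (intro ext add_closed) (auto simp: add closed N.a_comm)
  next
    fix f assume "f \<in> carrier ?H"
    then show "\<zero>\<^bsub>?H\<^esub> \<oplus>\<^bsub>?H\<^esub> f = f"
      by (intro ext add_closed zero_closed) (auto simp: zero add closed)
  qed (auto intro: add_closed zero_closed)
  then show ?thesis
  proof (rule moduleI[OF M.is_cring])
    fix a b f assume "a \<in> carrier R" "b \<in> carrier R" "f \<in> carrier ?H"
    then show "(a \<oplus>\<^bsub>R\<^esub> b) \<odot>\<^bsub>?H\<^esub> f = a \<odot>\<^bsub>?H\<^esub> f \<oplus>\<^bsub>?H\<^esub> b \<odot>\<^bsub>?H\<^esub> f"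
      by (intro ext add_closed smult_closed) (auto simp: add smult closed N.smult_l_distr)
  next
    fix a f g assume "a \<in> carrier R" "f \<in> carrier ?H" "g \<in> carrier ?H"
    then show "a \<odot>\<^bsub>?H\<^esub> (f \<oplus>\<^bsub>?H\<^esub> g) = a \<odot>\<^bsub>?H\<^esub> f \<oplus>\<^bsub>?H\<^esub> a \<odot>\<^bsub>?H\<^esub> g"
      by (intro ext add_closed smult_closed) (auto simp: add smult closed N.smult_r_distr)
  next
    fix a b f assume "a \<in> carrier R" "b \<in> carrier R" "f \<in> carrier ?H"
    then show "(a \<otimes>\<^bsub>R\<^esub> b) \<odot>\<^bsub>?H\<^esub> f = a \<odot>\<^bsub>?H\<^esub> (b \<odot>\<^bsub>?H\<^esub> f)"
      by (intro ext smult_closed) (auto simp: smult closed N.smult_assoc1)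
  next
    fix f assume "f \<in> carrier ?H"
    then show "\<one>\<^bsub>R\<^esub> \<odot>\<^bsub>?H\<^esub> f = f"
      by (intro ext smult_closed) (auto simp: smult closed)
  qed (rule smult_closed)
qed

lemma module_restrict_scalars:
  assumes "cring K" "f \<in> Ring.ring_hom K R" "module R M"
  shows "module K (restrict_scalars f M)"
proof -
  interpret K: cring K by fact
  interpret M: Module.module R M by fact
  note f = ring_hom_closed[OF assms(2)] ring_hom_add[OF assms(2)] ring_hom_mult[OF assms(2)]
    ring_hom_one[OF assms(2)]
  have "abelian_group (restrict_scalars f M)"
  proof (rule abelian_groupI)
    fix x assume "x \<in> carrier (restrict_scalars f M)"
    then show "\<exists>y\<in>carrier (restrict_scalars f M).
        y \<oplus>\<^bsub>restrict_scalars f M\<^esub> x = \<zero>\<^bsub>restrict_scalars f M\<^esub>"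
      by (intro bexI[of _ "\<ominus>\<^bsub>M\<^esub> x"]) (auto simp: restrict_scalars_def M.l_neg)
  qed (simp_all add: restrict_scalars_def M.a_ac)
  then show ?thesis
    by (rule moduleI[OF assms(1)])
       (auto simp: restrict_scalars_def f M.smult_l_distr M.smult_r_distr M.smult_assoc1)
qed

section \<open>Monomial ideals in three variables\<close>

lemma lookup_single_mult:
  fixes p :: "'a::cancel_comm_monoid_add \<Rightarrow>\<^sub>0 'b::comm_semiring_0"
  shows "Poly_Mapping.lookup (Poly_Mapping.single \<delta> c * p) (\<delta> + \<gamma>) = c * Poly_Mapping.lookup p \<gamma>"
    and "(\<And>\<gamma>. \<epsilon> \<noteq> \<delta> + \<gamma>) \<Longrightarrow> Poly_Mapping.lookup (Poly_Mapping.single \<delta> c * p) \<epsilon> = 0"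
  by (simp_all add: lookup_mult lookup_single when_mult)

lemma lookup_monom3_mult:
  "Poly_Mapping.lookup (monom3 \<delta> * p) (\<delta> + \<gamma>) = Poly_Mapping.lookup p \<gamma>"
  "(\<And>\<gamma>. \<epsilon> \<noteq> \<delta> + \<gamma>) \<Longrightarrow> Poly_Mapping.lookup (monom3 \<delta> * p) \<epsilon> = 0"
  unfolding monom3_def by (simp_all add: lookup_single_mult)

lemma sum_single_lookup:
  "(\<Sum>\<beta>\<in>Poly_Mapping.keys p. Poly_Mapping.single \<beta> (Poly_Mapping.lookup p \<beta>)) = p"
  by (rule poly_mapping_eqI) (auto simp: lookup_sum lookup_single when_def not_in_keys_iff_lookup_eq_zero)

lemma const3_mult_monom3: "const3 c * monom3 \<beta> = Poly_Mapping.single \<beta> c"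
  by (cases \<beta>) (simp add: const3_def monom3_def mult_single flip: zero_prod_def)

lemma monom3_mult: "monom3 \<beta> * monom3 \<gamma> = monom3 (\<beta> + \<gamma>)"
  by (simp add: monom3_def mult_single)

lemma lookup_const3_mult: "Poly_Mapping.lookup (const3 c * p) \<gamma> = c * Poly_Mapping.lookup p \<gamma>"
  using lookup_single_mult(1)[of "(0, 0, 0)" c p \<gamma>] by (cases \<gamma>) (simp add: const3_def)

lemma const3_ring_hom: "const3 \<in> Ring.ring_hom base_field poly3_ring"
  by (rule ring_hom_memI)
     (simp_all add: class_ring_simps const3_def mult_single single_add flip: zero_prod_def)

locale poly3_ideal =
  fixes I :: "'k::field poly3 set"
  assumes is_ideal: "ideal I poly3_ring"
begin

sublocale ideal I poly3_ring by (rule is_ideal)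

lemma mem_zero: "0 \<in> I"
  using zero_closed by (simp add: class_ring_simps)

lemma mem_add: "p \<in> I \<Longrightarrow> q \<in> I \<Longrightarrow> p + q \<in> I"
  using a_closed by (simp add: class_ring_simps)

lemma mem_mult: "p \<in> I \<Longrightarrow> q * p \<in> I"
  using I_l_closed by (simp add: class_ring_simps)

lemma mem_diff: "p \<in> I \<Longrightarrow> q \<in> I \<Longrightarrow> p - q \<in> I"
  using mem_add[of p "- 1 * q"] mem_mult[of q "- 1"] by simp

lemma mem_sum: "(\<And>x. x \<in> A \<Longrightarrow> f x \<in> I) \<Longrightarrow> (\<Sum>x\<in>A. f x) \<in> I"
  by (induction A rule: infinite_finite_induct) (auto simp: mem_zero mem_add)

lemma mem_coset: "q \<in> I +>\<^bsub>poly3_ring\<^esub> p \<longleftrightarrow> q - p \<in> I"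
proof -
  have "I +>\<^bsub>poly3_ring\<^esub> p = {h + p |h. h \<in> I}"
    by (auto simp: a_r_coset_def' class_ring_simps)
  then show ?thesis by (auto intro!: exI[of _ "q - p"])
qed

lemma coset_eq_iff: "I +>\<^bsub>poly3_ring\<^esub> p = I +>\<^bsub>poly3_ring\<^esub> q \<longleftrightarrow> p - q \<in> I"
proof
  assume "I +>\<^bsub>poly3_ring\<^esub> p = I +>\<^bsub>poly3_ring\<^esub> q"
  then show "p - q \<in> I" using mem_coset[of p p] mem_coset[of p q] mem_zero by simp
next
  assume pq: "p - q \<in> I"
  have "x - p \<in> I \<longleftrightarrow> x - q \<in> I" for x
    using mem_add[OF _ pq, of "x - p"] mem_diff[OF _ pq, of "x - q"] by auto
  then show "I +>\<^bsub>poly3_ring\<^esub> p = I +>\<^bsub>poly3_ring\<^esub> q" by (auto simp: mem_coset)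
qed

lemma carrier_quot: "carrier (quot_module poly3_ring I) = range (\<lambda>p. I +>\<^bsub>poly3_ring\<^esub> p)"
  by (auto simp: quot_module_def FactRing_def A_RCOSETS_def' class_ring_simps)

lemma zero_quot: "\<zero>\<^bsub>quot_module poly3_ring I\<^esub> = I +>\<^bsub>poly3_ring\<^esub> 0"
  by (auto simp: quot_module_def FactRing_def mem_coset)

lemma add_quot:
  "(I +>\<^bsub>poly3_ring\<^esub> p) \<oplus>\<^bsub>quot_module poly3_ring I\<^esub> (I +>\<^bsub>poly3_ring\<^esub> q) = I +>\<^bsub>poly3_ring\<^esub> (p + q)"
  using ring_hom_add[OF rcos_ring_hom, of p q]
  by (simp add: quot_module_def class_ring_simps)

lemma smult_quot:
  "q \<odot>\<^bsub>quot_module poly3_ring I\<^esub> (I +>\<^bsub>poly3_ring\<^esub> p) = I +>\<^bsub>poly3_ring\<^esub> (q * p)"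
  using ring_hom_mult[OF rcos_ring_hom, of q p]
  by (simp add: quot_module_def class_ring_simps)

lemma module_quot: "Module.module poly3_ring (quot_module poly3_ring I)"
  by (rule module_quot_module[OF _ is_ideal]) (rule class_cring.is_cring)

lemma vectorspace_quot: "class_vectorspace (restrict_scalars const3 (quot_module poly3_ring I))"
  unfolding class_vectorspace_def vectorspace_def
  using module_restrict_scalars[OF class_cring.is_cring const3_ring_hom module_quot] class_field by blast

lemma vectorspace_tangent: "class_vectorspace (tangent_space I)"
  unfolding class_vectorspace_def vectorspace_def tangent_space_def
  using module_restrict_scalars[OF class_cring.is_cring const3_ring_hom
      module_hom_module[OF module_ideal_module[OF class_cring.is_cring is_ideal] module_quot]]
    class_field by blast

end

definition std_exps :: "'k::field poly3 set \<Rightarrow> (nat \<times> nat \<times> nat) set" where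
  "std_exps I = {\<gamma>. monom3 \<gamma> \<notin> I}"

text \<open>An arbitrary representative is chosen. The value is meaningful when \<open>C\<close> is
  a coset of a monomial ideal and \<gamma> is an exponent outside that ideal, see
  \<open>coset_coeff_coset\<close>.\<close>

definition coset_coeff :: "nat \<times> nat \<times> nat \<Rightarrow> 'k::field poly3 set \<Rightarrow> 'k" where
  "coset_coeff \<gamma> C = Poly_Mapping.lookup (SOME p. p \<in> C) \<gamma>"

locale monomial_ideal3 = poly3_ideal +
  assumes monom3_key_mem: "p \<in> I \<Longrightarrow> \<beta> \<in> Poly_Mapping.keys p \<Longrightarrow> monom3 \<beta> \<in> I"
begin

lemma mem_single: "monom3 \<beta> \<in> I \<Longrightarrow> Poly_Mapping.single \<beta> c \<in> I"
  using mem_mult[of "monom3 \<beta>" "const3 c"] by (simp add: const3_mult_monom3)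

lemma mem_iff_keys: "p \<in> I \<longleftrightarrow> (\<forall>\<beta>\<in>Poly_Mapping.keys p. monom3 \<beta> \<in> I)"
proof
  assume "\<forall>\<beta>\<in>Poly_Mapping.keys p. monom3 \<beta> \<in> I"
  then have "(\<Sum>\<beta>\<in>Poly_Mapping.keys p. Poly_Mapping.single \<beta> (Poly_Mapping.lookup p \<beta>)) \<in> I"
    by (intro mem_sum mem_single) auto
  then show "p \<in> I" by (simp add: sum_single_lookup)
qed (auto intro: monom3_key_mem)

lemma lookup_std: "p \<in> I \<Longrightarrow> \<gamma> \<in> std_exps I \<Longrightarrow> Poly_Mapping.lookup p \<gamma> = 0"
  using monom3_key_mem[of p \<gamma>] by (auto simp: std_exps_def in_keys_iff)

text \<open>Two representatives differ by an element of \<open>I\<close>, in which no monomial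
  outside \<open>I\<close> occurs.\<close>

lemma coset_coeff_coset:
  assumes "\<gamma> \<in> std_exps I"
  shows "coset_coeff \<gamma> (I +>\<^bsub>poly3_ring\<^esub> p) = Poly_Mapping.lookup p \<gamma>"
proof -
  have "(SOME q. q \<in> I +>\<^bsub>poly3_ring\<^esub> p) \<in> I +>\<^bsub>poly3_ring\<^esub> p"
    by (rule someI[of _ p]) (simp add: mem_coset mem_zero)
  then show ?thesis
    using lookup_std[OF _ assms] by (fastforce simp: coset_coeff_def mem_coset lookup_minus)
qed

lemma coset_eqI:
  assumes "\<And>\<gamma>. \<gamma> \<in> std_exps I \<Longrightarrow> Poly_Mapping.lookup p \<gamma> = Poly_Mapping.lookup q \<gamma>"
  shows "I +>\<^bsub>poly3_ring\<^esub> p = I +>\<^bsub>poly3_ring\<^esub> q"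
proof -
  have "monom3 \<beta> \<in> I" if "\<beta> \<in> Poly_Mapping.keys (p - q)" for \<beta>
    using that assms[of \<beta>] by (cases "monom3 \<beta> \<in> I") (simp_all add: std_exps_def in_keys_iff lookup_minus)
  then show ?thesis unfolding coset_eq_iff by (subst mem_iff_keys) blast
qed

lemma std_exps_down:
  assumes "(a, b, c) \<in> std_exps I" "a' \<le> a" "b' \<le> b" "c' \<le> c"
  shows "(a', b', c') \<in> std_exps I"
proof (rule ccontr)
  assume "\<not> ?thesis"
  then have "monom3 (a - a', b - b', c - c') * monom3 (a', b', c') \<in> I"
    by (intro mem_mult) (simp add: std_exps_def)
  with assms show False by (simp add: monom3_mult std_exps_def)
qed

text \<open>The coefficients at these exponents are dual to the cosets of the monomials and separate
  cosets; duality gives one inequality, separation the other.\<close>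

lemma card_std_exps:
  assumes "vectorspace.fin_dim base_field (restrict_scalars const3 (quot_module poly3_ring I))"
  shows "finite (std_exps I)"
    and "card (std_exps I)
           = vectorspace.dim base_field (restrict_scalars const3 (quot_module poly3_ring I))"
proof -
  let ?V = "restrict_scalars const3 (quot_module poly3_ring I)"
  interpret V: class_vectorspace ?V by (rule vectorspace_quot)
  have carrier: "carrier ?V = range (\<lambda>p. I +>\<^bsub>poly3_ring\<^esub> p)"
    by (simp add: restrict_scalars_def carrier_quot)
  have form: "linear_form ?V (coset_coeff \<gamma>)" if "\<gamma> \<in> std_exps I" for \<gamma>
    using that unfolding linear_form_def carrier
    by (auto simp: restrict_scalars_def add_quot smult_quot coset_coeff_coset lookup_add
        lookup_const3_mult)
  have le: "card E \<le> V.dim" if "finite E" "E \<subseteq> std_exps I" for E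
    using that assms form
    by (intro V.card_le_dim_dual[of _ coset_coeff "\<lambda>\<gamma>. I +>\<^bsub>poly3_ring\<^esub> monom3 \<gamma>"])
       (auto simp: carrier coset_coeff_coset monom3_def lookup_single when_def subset_iff
         split: if_splits)
  \<comment> \<open>An infinite set has finite subsets of every size, against the duality
    bound.\<close>
  show fin: "finite (std_exps I)"
  proof (rule ccontr)
    assume "infinite (std_exps I)"
    then obtain E where "finite E" "E \<subseteq> std_exps I" "card E = Suc V.dim"
      using infinite_arbitrarily_large by blast
    with le show False by fastforce
  qed
  have "V.dim \<le> card (std_exps I)"
  proof (rule V.dim_le_card_separating(2)[OF fin form])
    fix C assume "C \<in> carrier ?V" and C0: "\<And>\<gamma>. \<gamma> \<in> std_exps I \<Longrightarrow> coset_coeff \<gamma> C = 0"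
    then obtain p where C: "C = I +>\<^bsub>poly3_ring\<^esub> p" unfolding carrier by blast
    have "I +>\<^bsub>poly3_ring\<^esub> p = I +>\<^bsub>poly3_ring\<^esub> 0"
      using C0 by (intro coset_eqI) (simp add: C coset_coeff_coset)
    then show "C = \<zero>\<^bsub>?V\<^esub>" by (simp add: C restrict_scalars_def zero_quot)
  qed
  with le[OF fin] show "card (std_exps I) = V.dim" by simp
qed

end

section \<open>Borel-fixed ideals and powers of the maximal ideal\<close>

lemma const3_one: "const3 1 = 1"
  by (simp add: const3_def flip: zero_prod_def)

lemma const3_zero: "const3 0 = 0"
  by (simp add: const3_def)

lemma power_const3_varX: "(const3 a * varX) ^ n = Poly_Mapping.single (n, 0, 0) (a ^ n)"
  unfolding varX_def const3_mult_monom3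
  by (induction n) (simp_all add: mult_single flip: zero_prod_def)

lemma power_const3_varY: "(const3 a * varY) ^ n = Poly_Mapping.single (0, n, 0) (a ^ n)"
  unfolding varY_def const3_mult_monom3
  by (induction n) (simp_all add: mult_single flip: zero_prod_def)

lemma power_const3_varZ: "(const3 a * varZ) ^ n = Poly_Mapping.single (0, 0, n) (a ^ n)"
  unfolding varZ_def const3_mult_monom3
  by (induction n) (simp_all add: mult_single flip: zero_prod_def)

lemma lookup_subst3_diag:
  "Poly_Mapping.lookup (subst3 (const3 a * varX) (const3 b * varY) (const3 c * varZ) p) (i, j, k)
     = a ^ i * b ^ j * c ^ k * Poly_Mapping.lookup p (i, j, k)"
proof -
  let ?w = "\<lambda>(i, j, k). a ^ i * b ^ j * c ^ k"
  have "subst3 (const3 a * varX) (const3 b * varY) (const3 c * varZ) p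
      = (\<Sum>\<beta>\<in>Poly_Mapping.keys p. Poly_Mapping.single \<beta> (Poly_Mapping.lookup p \<beta> * ?w \<beta>))"
    unfolding subst3_def power_const3_varX power_const3_varY power_const3_varZ
    by (intro sum.cong) (auto simp: const3_def mult_single mult.assoc)
  then show ?thesis
    by (auto simp: lookup_sum lookup_single when_def not_in_keys_iff_lookup_eq_zero)
qed

lemma subst3_monom3: "subst3 f g h (monom3 (i, j, k)) = f ^ i * g ^ j * h ^ k"
  by (simp add: subst3_def monom3_def const3_one)

text \<open>The powers of 2 are distinct in characteristic 0, so 2 is put in a position where the
  exponents differ and 1 elsewhere.\<close>

lemma exists_distinguishing_weight:
  fixes i j k i' j' k' :: nat
  assumes "(i, j, k) \<noteq> (i', j', k')"
  shows "\<exists>a b c :: 'k::field_char_0. a \<noteq> 0 \<and> b \<noteq> 0 \<and> c \<noteq> 0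
           \<and> a ^ i * b ^ j * c ^ k \<noteq> a ^ i' * b ^ j' * c ^ k'"
proof -
  have inj: "(2::'k) ^ m = 2 ^ n \<longleftrightarrow> m = n" for m n
    using of_nat_eq_iff[of "2 ^ m" "2 ^ n", where 'a = 'k] by simp
  from assms consider "i \<noteq> i'" | "j \<noteq> j'" | "k \<noteq> k'" by auto
  then show ?thesis
  proof cases
    case 1
    then show ?thesis by (intro exI[of _ 2] exI[of _ 1]) (simp add: inj)
  next
    case 2
    then show ?thesis
      by (intro exI[of _ "1::'k"] exI[of _ "2::'k"] exI[of _ "1::'k"]) (simp add: inj)
  next
    case 3
    then show ?thesis
      by (intro exI[of _ "1::'k"] exI[of _ "1::'k"] exI[of _ "2::'k"]) (simp add: inj)
  qed
qed

lemma borel_fixed_subst3: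
  assumes "borel_fixed I" "p \<in> I" "a11 \<noteq> 0" "a22 \<noteq> 0" "a33 \<noteq> 0"
  shows "subst3 (const3 a11 * varX) (const3 a12 * varX + const3 a22 * varY)
      (const3 a13 * varX + const3 a23 * varY + const3 a33 * varZ) p \<in> I"
  using assms unfolding borel_fixed_def by blast

text \<open>If \<open>\<beta>\<^sub>0 \<noteq> \<beta>\<close> are exponents of \<open>p\<close> and the diagonal matrix \<open>t\<close> acts on \<open>x\<^bsup>\<beta>\<^esup>\<close> and
  \<open>x\<^bsup>\<beta>\<^sub>0\<^esup>\<close> by different scalars, then \<open>t p - t\<^bsup>\<beta>\<^sub>0\<^esup> p\<close> keeps \<open>\<beta>\<close> and loses \<open>\<beta>\<^sub>0\<close>.\<close>

lemma monomial_ideal3_of_borel_fixed: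
  fixes I :: "'k::field_char_0 poly3 set"
  assumes "ideal I poly3_ring" and borel: "borel_fixed I"
  shows "monomial_ideal3 I"
proof -
  interpret poly3_ideal I by (rule poly3_ideal.intro) fact
  have "monom3 \<beta> \<in> I" if "p \<in> I" "\<beta> \<in> Poly_Mapping.keys p" for p \<beta>
    using that
  proof (induction "card (Poly_Mapping.keys p)" arbitrary: p rule: less_induct)
    case less
    show ?case
    proof (cases "Poly_Mapping.keys p = {\<beta>}")
      case True
      define c where "c = Poly_Mapping.lookup p \<beta>"
      have c: "c \<noteq> 0" using less.prems(2) by (simp add: in_keys_iff c_def)
      have "p = Poly_Mapping.single \<beta> c"
        using sum_single_lookup[of p] by (simp add: True c_def)
      then have "const3 (inverse c) * p = monom3 \<beta>"
        using c by (intro poly_mapping_eqI)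
          (simp add: lookup_const3_mult monom3_def lookup_single when_def)
      then show ?thesis using mem_mult[OF less.prems(1), of "const3 (inverse c)"] by simp
    next
      case False
      then obtain \<beta>0 where \<beta>0: "\<beta>0 \<in> Poly_Mapping.keys p" "\<beta>0 \<noteq> \<beta>"
        using less.prems(2) by blast
      obtain i j k where ijk: "\<beta> = (i, j, k)" by (cases \<beta>)
      obtain i' j' k' where ijk': "\<beta>0 = (i', j', k')" by (cases \<beta>0)
      obtain a b c :: 'k where abc: "a \<noteq> 0" "b \<noteq> 0" "c \<noteq> 0"
        "a ^ i * b ^ j * c ^ k \<noteq> a ^ i' * b ^ j' * c ^ k'"
        using exists_distinguishing_weight[of i j k i' j' k'] \<beta>0(2) ijk ijk' by blast
      define q where "q = subst3 (const3 a * varX) (const3 b * varY) (const3 c * varZ) p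
        - const3 (a ^ i' * b ^ j' * c ^ k') * p"
      have look: "Poly_Mapping.lookup q (l, m, n)
          = (a ^ l * b ^ m * c ^ n - a ^ i' * b ^ j' * c ^ k') * Poly_Mapping.lookup p (l, m, n)"
        for l m n
        by (simp add: q_def lookup_minus lookup_subst3_diag lookup_const3_mult left_diff_distrib)
      \<comment> \<open>With zeros above the diagonal, the Borel substitution becomes the diagonal
        one.\<close>
      have "q \<in> I"
        using borel_fixed_subst3[OF borel less.prems(1) abc(1-3), of 0 0 0] less.prems(1)
        by (simp add: q_def const3_zero mem_diff mem_mult)
      moreover have "\<beta> \<in> Poly_Mapping.keys q"
        using less.prems(2) abc(4) by (simp add: in_keys_iff ijk look)
      moreover have "Poly_Mapping.keys q \<subset> Poly_Mapping.keys p"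
      proof
        show "Poly_Mapping.keys q \<subseteq> Poly_Mapping.keys p" by (auto simp: in_keys_iff look)
        show "Poly_Mapping.keys q \<noteq> Poly_Mapping.keys p"
          using \<beta>0(1) look[of i' j' k'] by (auto simp: in_keys_iff ijk')
      qed
      then have "card (Poly_Mapping.keys q) < card (Poly_Mapping.keys p)"
        by (simp add: psubset_card_mono)
      ultimately show ?thesis using less.hyps by blast
    qed
  qed
  then show ?thesis using poly3_ideal_axioms
    by (intro monomial_ideal3.intro monomial_ideal3_axioms.intro)
qed

lemma power_varX: "varX ^ n = monom3 (n, 0, 0)"
  using power_const3_varX[of 1 n] by (simp add: const3_one monom3_def)

lemma power_varY: "varY ^ n = monom3 (0, n, 0)"
  using power_const3_varY[of 1 n] by (simp add: const3_one monom3_def)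

lemma power_varZ: "varZ ^ n = monom3 (0, 0, n)"
  using power_const3_varZ[of 1 n] by (simp add: const3_one monom3_def)

lemma of_nat_poly3: "of_nat n = const3 (of_nat n)"
  by (simp add: const3_def flip: zero_prod_def)

text \<open>Under y -> x + y the expansion of x^i y^(j+1) z^k contains x^(i+1) y^j z^k with
  coefficient j + 1, nonzero in characteristic 0, and a monomial ideal contains each monomial of its
  elements. The substitution z -> y + z works alike. The exchanges in \<open>borel3\<close> are the
  contrapositives.\<close>

lemma borel3_std_exps:
  fixes I :: "'k::field_char_0 poly3 set"
  assumes "ideal I poly3_ring" and borel: "borel_fixed I"
  shows "borel3 (std_exps I)"
proof -
  interpret monomial_ideal3 I using assms by (rule monomial_ideal3_of_borel_fixed)
  have y: "monom3 (Suc i, j, k) \<in> I" if mem: "monom3 (i, Suc j, k) \<in> I" for i j k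
  proof -
    let ?n = "Suc j"
    have "varX ^ i * (varX + varY) ^ ?n * varZ ^ k \<in> I"
      using borel_fixed_subst3[OF borel mem, of 1 1 1 1 0 0]
      by (simp add: const3_zero const3_one subst3_monom3)
    also have "varX ^ i * (varX + varY) ^ ?n * varZ ^ k
        = (\<Sum>m\<le>?n. Poly_Mapping.single (i + m, ?n - m, k) (of_nat (?n choose m) :: 'k))"
      unfolding binomial_ring power_varX power_varY power_varZ sum_distrib_left sum_distrib_right
        of_nat_poly3 const3_mult_monom3
      by (intro sum.cong) (simp_all add: monom3_def mult_single)
    finally show ?thesis
    proof (rule monom3_key_mem)
      have "Poly_Mapping.lookup (\<Sum>m\<le>?n. Poly_Mapping.single (i + m, ?n - m, k) (of_nat (?n choose m) :: 'k))
          (Suc i, j, k) = (\<Sum>m\<le>?n. if m = 1 then of_nat (?n choose m) else 0)"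
        unfolding lookup_sum lookup_single by (intro sum.cong) (auto simp: when_def)
      then show "(Suc i, j, k) \<in> Poly_Mapping.keys
          (\<Sum>m\<le>?n. Poly_Mapping.single (i + m, ?n - m, k) (of_nat (?n choose m) :: 'k))"
        by (simp add: in_keys_iff del: of_nat_Suc)
    qed
  qed
  have z: "monom3 (i, Suc j, k) \<in> I" if mem: "monom3 (i, j, Suc k) \<in> I" for i j k
  proof -
    let ?n = "Suc k"
    have "varX ^ i * varY ^ j * (varY + varZ) ^ ?n \<in> I"
      using borel_fixed_subst3[OF borel mem, of 1 1 1 0 0 1]
      by (simp add: const3_zero const3_one subst3_monom3)
    also have "varX ^ i * varY ^ j * (varY + varZ) ^ ?n
        = (\<Sum>m\<le>?n. Poly_Mapping.single (i, j + m, ?n - m) (of_nat (?n choose m) :: 'k))"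
      unfolding binomial_ring power_varX power_varY power_varZ sum_distrib_left sum_distrib_right
        of_nat_poly3 const3_mult_monom3
      by (intro sum.cong) (simp_all add: monom3_def mult_single)
    finally show ?thesis
    proof (rule monom3_key_mem)
      have "Poly_Mapping.lookup (\<Sum>m\<le>?n. Poly_Mapping.single (i, j + m, ?n - m) (of_nat (?n choose m) :: 'k))
          (i, Suc j, k) = (\<Sum>m\<le>?n. if m = 1 then of_nat (?n choose m) else 0)"
        unfolding lookup_sum lookup_single by (intro sum.cong) (auto simp: when_def)
      then show "(i, Suc j, k) \<in> Poly_Mapping.keys
          (\<Sum>m\<le>?n. Poly_Mapping.single (i, j + m, ?n - m) (of_nat (?n choose m) :: 'k))"
        by (simp add: in_keys_iff del: of_nat_Suc)
    qed
  qed
  show ?thesis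
    unfolding borel3_def
  proof (intro conjI allI impI)
    fix i j k assume "(i, j, Suc k) \<in> std_exps I"
    then show "(i, j, k) \<in> std_exps I" by (rule std_exps_down) auto
  qed (use y z in \<open>auto simp: std_exps_def\<close>)
qed

section \<open>Powers of the maximal ideal in terms of degrees\<close>

definition degree_ge :: "nat \<Rightarrow> 'k::field poly3 set" where
  "degree_ge r = {p. \<forall>(a, b, c)\<in>Poly_Mapping.keys p. r \<le> a + b + c}"

lemma poly3_idealI:
  fixes I :: "'a::field poly3 set"
  assumes "0 \<in> I" "\<And>p q. p \<in> I \<Longrightarrow> q \<in> I \<Longrightarrow> p + q \<in> I" "\<And>p q. p \<in> I \<Longrightarrow> q * p \<in> I"
  shows "ideal I poly3_ring"
proof (rule idealI)
  show "ring poly3_ring" by (rule class_ring.ring_axioms)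
  note a_group = abelian_group.a_group[OF ring.is_abelian_group[OF this]]
  show "subgroup I (add_monoid poly3_ring)"
  proof (rule group.subgroupI[OF a_group])
    fix p assume p: "p \<in> I"
    have "inv\<^bsub>add_monoid poly3_ring\<^esub> p = - p"
      unfolding a_inv_def[symmetric] by (simp add: class_ring_simps)
    then show "inv\<^bsub>add_monoid poly3_ring\<^esub> p \<in> I" using assms(3)[OF p, of "- 1"] by simp
  qed (use assms in \<open>auto simp: class_ring_simps\<close>)
qed (use assms in \<open>auto simp: class_ring_simps mult.commute\<close>)

lemma degree_ge_ideal: "ideal (degree_ge r) poly3_ring"
proof (rule poly3_idealI)
  fix p q :: "'a poly3"
  assume p: "p \<in> degree_ge r"
  show "q * p \<in> degree_ge r"
    using p keys_mult[of q p] by (fastforce simp: degree_ge_def)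
  assume q: "q \<in> degree_ge r"
  show "p + q \<in> degree_ge r"
    using p q Poly_Mapping.keys_add[of p q] by (fastforce simp: degree_ge_def)
qed (simp add: degree_ge_def)

lemma degree_ge_subset:
  fixes J :: "'k::field poly3 set"
  assumes "ideal J poly3_ring" "\<And>a b c. r \<le> a + b + c \<Longrightarrow> monom3 (a, b, c) \<in> J"
  shows "degree_ge r \<subseteq> J"
proof
  interpret poly3_ideal J by (rule poly3_ideal.intro) fact
  fix p :: "'k poly3" assume p: "p \<in> degree_ge r"
  have "(\<Sum>\<beta>\<in>Poly_Mapping.keys p. const3 (Poly_Mapping.lookup p \<beta>) * monom3 \<beta>) \<in> J"
    using p assms(2) by (intro mem_sum mem_mult) (auto simp: degree_ge_def)
  then show "p \<in> J" by (simp add: const3_mult_monom3 sum_single_lookup)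
qed

lemma monom3_mem_degree_ge: "monom3 (a, b, c) \<in> degree_ge r \<longleftrightarrow> r \<le> a + b + c"
  by (simp add: degree_ge_def monom3_def)

text \<open>This factorization serves both the generation of the maximal ideal by the variables and
  the inductive step for its powers.\<close>

lemma monom3_split_var:
  assumes "Suc r \<le> a + b + c"
  obtains \<gamma> v where "monom3 (a, b, c) = monom3 \<gamma> * (v :: 'k::field poly3)"
    "v \<in> {varX, varY, varZ}" "monom3 \<gamma> \<in> (degree_ge r :: 'k poly3 set)"
proof -
  from assms consider a' where "a = Suc a'" | b' where "b = Suc b'" | c' where "c = Suc c'"
    by (cases a; cases b; cases c) auto
  then show ?thesis
  proof cases
    case 1
    with assms show ?thesis
      by (intro that[of "(a', b, c)" varX]) (auto simp: varX_def monom3_mult monom3_mem_degree_ge)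
  next
    case 2
    with assms show ?thesis
      by (intro that[of "(a, b', c)" varY]) (auto simp: varY_def monom3_mult monom3_mem_degree_ge)
  next
    case 3
    with assms show ?thesis
      by (intro that[of "(a, b, c')" varZ]) (auto simp: varZ_def monom3_mult monom3_mem_degree_ge)
  qed
qed

lemma max_ideal_eq: "max_ideal = degree_ge 1"
proof
  show "max_ideal \<subseteq> (degree_ge 1 :: 'a poly3 set)"
    unfolding max_ideal_def
    by (rule ring.genideal_minimal[OF class_ring.ring_axioms degree_ge_ideal])
       (auto simp: varX_def varY_def varZ_def monom3_mem_degree_ge)
  have ideal: "ideal (max_ideal :: 'a poly3 set) poly3_ring"
    unfolding max_ideal_def by (rule ring.genideal_ideal[OF class_ring.ring_axioms]) simp
  then interpret poly3_ideal "max_ideal :: 'a poly3 set" by (rule poly3_ideal.intro)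
  show "degree_ge 1 \<subseteq> (max_ideal :: 'a poly3 set)"
  proof (rule degree_ge_subset[OF ideal])
    fix a b c :: nat assume "1 \<le> a + b + c"
    then have "Suc 0 \<le> a + b + c" by simp
    then obtain \<gamma> and v :: "'a poly3" where "monom3 (a, b, c) = monom3 \<gamma> * v" "v \<in> {varX, varY, varZ}"
      by (rule monom3_split_var)
    moreover have "{varX, varY, varZ} \<subseteq> (max_ideal :: 'a poly3 set)"
      unfolding max_ideal_def by (rule ring.genideal_self[OF class_ring.ring_axioms]) simp
    ultimately show "monom3 (a, b, c) \<in> (max_ideal :: 'a poly3 set)"
      using mem_mult by auto
  qed
qed

text \<open>One inclusion adds degrees. For the other, a monomial of degree at least r + 1 is a
  variable times one of degree at least r.\<close>

lemma ideal_prod_degree_ge: "ideal_prod poly3_ring (degree_ge r) (degree_ge 1) = degree_ge (Suc r)"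
proof
  show "ideal_prod poly3_ring (degree_ge r) (degree_ge 1) \<subseteq> (degree_ge (Suc r) :: 'a poly3 set)"
  proof
    fix p :: "'a poly3" assume "p \<in> ideal_prod poly3_ring (degree_ge r) (degree_ge 1)"
    then show "p \<in> degree_ge (Suc r)"
    proof induction
      case (prod p q)
      then show ?case
        using keys_mult[of p q] by (fastforce simp: degree_ge_def class_ring_simps)
    next
      case (sum p q)
      then show ?case
        using Poly_Mapping.keys_add[of p q] by (fastforce simp: degree_ge_def class_ring_simps)
    qed
  qed
  show "(degree_ge (Suc r) :: 'a poly3 set) \<subseteq> ideal_prod poly3_ring (degree_ge r) (degree_ge 1)"
  proof (rule degree_ge_subset)
    show "ideal (ideal_prod poly3_ring (degree_ge r) (degree_ge 1 :: 'a poly3 set)) poly3_ring"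
      by (rule ring.ideal_prod_is_ideal[OF class_ring.ring_axioms degree_ge_ideal degree_ge_ideal])
    fix a b c assume "Suc r \<le> a + b + c"
    then obtain \<gamma> and v :: "'a poly3" where eq: "monom3 (a, b, c) = monom3 \<gamma> * v"
      and v: "v \<in> {varX, varY, varZ}" and \<gamma>: "monom3 \<gamma> \<in> (degree_ge r :: 'a poly3 set)"
      by (rule monom3_split_var)
    have "v \<in> degree_ge 1"
      using v by (auto simp: varX_def varY_def varZ_def monom3_mem_degree_ge)
    then show "monom3 (a, b, c) \<in> ideal_prod poly3_ring (degree_ge r) (degree_ge 1 :: 'a poly3 set)"
      using ideal_prod.prod[OF \<gamma>, of v "degree_ge 1" poly3_ring] by (simp add: eq class_ring_simps)
  qed
qed

lemma max_ideal_power_eq: "max_ideal_power r = degree_ge r"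
  unfolding max_ideal_power_def
proof (induction r)
  case 0
  show ?case by (simp add: nat_pow_def ideals_set_def degree_ge_def class_ring_simps)
next
  case (Suc r)
  then show ?case
    by (simp add: nat_pow_def ideals_set_def max_ideal_eq ideal_prod_degree_ge del: One_nat_def)
qed

lemma monomial_ideal3_degree_ge: "monomial_ideal3 (degree_ge r)"
  by (intro monomial_ideal3.intro poly3_ideal.intro monomial_ideal3_axioms.intro degree_ge_ideal)
     (auto simp: degree_ge_def monom3_def)

lemma std_exps_degree_ge: "std_exps (degree_ge r) = simplex r"
  by (auto simp: std_exps_def simplex_def monom3_mem_degree_ge)

section \<open>Tangent vectors and arrows\<close>

lemma exists_lex_extremal:
  fixes lo hi :: "'x \<Rightarrow> nat"
  assumes "N x0" and bound: "\<And>x. N x \<Longrightarrow> hi x \<le> K"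
  obtains x where "N x" "\<And>y. N y \<Longrightarrow> lo x \<le> lo y" "\<And>y. N y \<Longrightarrow> lo y = lo x \<Longrightarrow> hi y \<le> hi x"
proof -
  obtain x1 where x1: "N x1" "\<And>y. N y \<Longrightarrow> lo x1 \<le> lo y"
    using ex_has_least_nat[of N x0 lo] assms(1) by blast
  have "\<forall>y. N y \<and> lo y = lo x1 \<longrightarrow> hi y < Suc K" using bound by (auto simp: less_Suc_eq_le)
  then obtain x where "N x \<and> lo x = lo x1" "\<And>y. N y \<and> lo y = lo x1 \<Longrightarrow> hi y \<le> hi x"
    using ex_has_greatest_nat[of "\<lambda>x. N x \<and> lo x = lo x1" x1 hi "Suc K"] x1(1) by blast
  then show thesis using x1(2) by (intro that[of x]) auto
qed

text \<open>\<open>N \<beta> \<gamma>\<close> models that a fixed homomorphism \<open>I \<rightarrow> S/I\<close> has a nonzero coefficient from \<open>x\<^bsup>\<beta>\<^esup>\<close> to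
  \<open>x\<^bsup>\<gamma>\<^esup>\<close>, where \<open>B\<close> is the set of exponents outside \<open>I\<close>.\<close>

locale arrow_system =
  fixes B :: "(nat \<times> nat \<times> nat) set"
    and N :: "nat \<times> nat \<times> nat \<Rightarrow> nat \<times> nat \<times> nat \<Rightarrow> bool"
  assumes finite_B: "finite B"
    and N_B: "N \<beta> \<gamma> \<Longrightarrow> \<beta> \<notin> B \<and> \<gamma> \<in> B"
    and N_up: "N \<beta> \<gamma> \<Longrightarrow> \<delta> + \<gamma> \<in> B \<Longrightarrow> N (\<delta> + \<beta>) (\<delta> + \<gamma>)"
    and N_down: "N (\<delta> + \<beta>) \<gamma> \<Longrightarrow> \<beta> \<notin> B \<Longrightarrow> \<exists>\<gamma>'. \<gamma> = \<delta> + \<gamma>' \<and> N \<beta> \<gamma>'"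
begin

text \<open>If \<gamma> + e2 stayed in \<open>B\<close>, translation by e2 would give a nonzero
  arrow with the same third and a larger second exponent. If \<beta> - e3 were outside
  \<open>B\<close>, the arrow would come from one ending at \<gamma> - e3. Every nonzero arrow must
  have the signature, since extremality is taken over all of them.\<close>

lemma ex_arrow_ppn:
  assumes "N \<beta> \<gamma>"
    and sig: "\<And>b1 b2 b3 g1 g2 g3. N (b1, b2, b3) (g1, g2, g3) \<Longrightarrow> b1 \<le> g1 \<and> b2 \<le> g2 \<and> g3 < b3"
  shows "\<exists>e\<in>{((b1, b2, b3), (g1, g2, g3)). (g1, g2, g3) \<in> B \<and> (g1, Suc g2, g3) \<notin> B
       \<and> (b1, b2, b3) \<notin> B \<and> (b1, b2, b3 - 1) \<in> B \<and> b1 \<le> g1 \<and> b2 \<le> g2 \<and> g3 < b3}.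
       N (fst e) (snd e)"
proof -
  let ?N = "\<lambda>e. N (fst e) (snd e)"
  let ?lo = "\<lambda>e. snd (snd (snd e))" and ?hi = "\<lambda>e. fst (snd (snd e))"
  have bound: "?hi e \<le> Max ((fst \<circ> snd) ` B)" if "?N e" for e
    using finite_B N_B[OF that] by (intro Max_ge) force+
  have "?N (\<beta>, \<gamma>)" using assms(1) by simp
  then obtain e where e: "?N e" "\<And>e'. ?N e' \<Longrightarrow> ?lo e \<le> ?lo e'"
    "\<And>e'. ?N e' \<Longrightarrow> ?lo e' = ?lo e \<Longrightarrow> ?hi e' \<le> ?hi e"
    using bound by (rule exists_lex_extremal[of ?N _ ?hi _ ?lo]) blast+
  obtain b1 b2 b3 g1 g2 g3 where e_eq: "e = ((b1, b2, b3), (g1, g2, g3))" by (cases e) auto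
  with e have N: "N (b1, b2, b3) (g1, g2, g3)" by simp
  have "(g1, Suc g2, g3) \<notin> B"
    using N_up[OF N, of "(0, 1, 0)"] e(3)[of "((b1, Suc b2, b3), (g1, Suc g2, g3))"]
    by (auto simp: e_eq)
  moreover have "(b1, b2, b3 - 1) \<in> B"
  proof (rule ccontr)
    assume "(b1, b2, b3 - 1) \<notin> B"
    \<comment> \<open>The signature gives g3 < b3, so \<open>b3 - 1\<close> is a true
      predecessor.\<close>
    moreover have "N ((0, 0, 1) + (b1, b2, b3 - 1)) (g1, g2, g3)"
      using N sig[OF N] by simp
    ultimately obtain \<gamma>' where \<gamma>': "(g1, g2, g3) = (0, 0, 1) + \<gamma>'" "N (b1, b2, b3 - 1) \<gamma>'"
      using N_down by blast
    with e(2)[of "((b1, b2, b3 - 1), \<gamma>')"] show False by (cases \<gamma>') (simp add: e_eq)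
  qed
  ultimately show ?thesis
    using N_B[OF N] sig[OF N] N by (intro bexI[of _ e]) (auto simp: e_eq)
qed

text \<open>Translation by e3 would contradict maximality and translation back by e2 minimality; as
  g2 < b2, \<open>b2 - 1\<close> is a true predecessor.\<close>

lemma ex_arrow_nnp:
  assumes "N \<beta> \<gamma>"
    and sig: "\<And>b1 b2 b3 g1 g2 g3. N (b1, b2, b3) (g1, g2, g3) \<Longrightarrow> g1 < b1 \<and> g2 < b2 \<and> b3 \<le> g3"
  shows "\<exists>e\<in>{((b1, b2, b3), (g1, g2, g3)). (g1, g2, g3) \<in> B \<and> (g1, g2, Suc g3) \<notin> B
       \<and> (b1, b2, b3) \<notin> B \<and> (b1, b2 - 1, b3) \<in> B \<and> g1 < b1 \<and> g2 < b2 \<and> b3 \<le> g3}.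
       N (fst e) (snd e)"
proof -
  let ?N = "\<lambda>e. N (fst e) (snd e)"
  let ?hi = "\<lambda>e. snd (snd (snd e))" and ?lo = "\<lambda>e. fst (snd (snd e))"
  have bound: "?hi e \<le> Max ((snd \<circ> snd) ` B)" if "?N e" for e
    using finite_B N_B[OF that] by (intro Max_ge) force+
  have "?N (\<beta>, \<gamma>)" using assms(1) by simp
  then obtain e where e: "?N e" "\<And>e'. ?N e' \<Longrightarrow> ?lo e \<le> ?lo e'"
    "\<And>e'. ?N e' \<Longrightarrow> ?lo e' = ?lo e \<Longrightarrow> ?hi e' \<le> ?hi e"
    using bound by (rule exists_lex_extremal[of ?N _ ?hi _ ?lo]) blast+
  obtain b1 b2 b3 g1 g2 g3 where e_eq: "e = ((b1, b2, b3), (g1, g2, g3))" by (cases e) auto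
  with e have N: "N (b1, b2, b3) (g1, g2, g3)" by simp
  have "(g1, g2, Suc g3) \<notin> B"
    using N_up[OF N, of "(0, 0, 1)"] e(3)[of "((b1, b2, Suc b3), (g1, g2, Suc g3))"]
    by (auto simp: e_eq)
  moreover have "(b1, b2 - 1, b3) \<in> B"
  proof (rule ccontr)
    assume "(b1, b2 - 1, b3) \<notin> B"
    moreover have "N ((0, 1, 0) + (b1, b2 - 1, b3)) (g1, g2, g3)"
      using N sig[OF N] by simp
    ultimately obtain \<gamma>' where \<gamma>': "(g1, g2, g3) = (0, 1, 0) + \<gamma>'" "N (b1, b2 - 1, b3) \<gamma>'"
      using N_down by blast
    with e(2)[of "((b1, b2 - 1, b3), \<gamma>')"] show False by (cases \<gamma>') (simp add: e_eq)
  qed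
  ultimately show ?thesis
    using N_B[OF N] sig[OF N] N by (intro bexI[of _ e]) (auto simp: e_eq)
qed

end

section \<open>Coefficients of tangent vectors\<close>

context poly3_ideal
begin

lemma tangentD:
  assumes "\<phi> \<in> carrier (tangent_space I)"
  shows "p \<in> I \<Longrightarrow> \<exists>q. \<phi> p = I +>\<^bsub>poly3_ring\<^esub> q"
    and "p \<in> I \<Longrightarrow> q \<in> I \<Longrightarrow> \<phi> (p + q) = \<phi> p \<oplus>\<^bsub>quot_module poly3_ring I\<^esub> \<phi> q"
    and "p \<in> I \<Longrightarrow> \<phi> (q * p) = q \<odot>\<^bsub>quot_module poly3_ring I\<^esub> \<phi> p"
    and "p \<notin> I \<Longrightarrow> \<phi> p = undefined"
  using assms
  by (auto simp: tangent_space_def restrict_scalars_def hom_module_def ideal_module_def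
      LinearCombinations.module_hom_def carrier_quot extensional_def class_ring_simps Pi_iff image_iff)

lemma tangentI:
  assumes "\<And>p. p \<in> I \<Longrightarrow> \<exists>q. \<phi> p = I +>\<^bsub>poly3_ring\<^esub> q"
    and "\<And>p q. p \<in> I \<Longrightarrow> q \<in> I \<Longrightarrow> \<phi> (p + q) = \<phi> p \<oplus>\<^bsub>quot_module poly3_ring I\<^esub> \<phi> q"
    and "\<And>p q. p \<in> I \<Longrightarrow> \<phi> (q * p) = q \<odot>\<^bsub>quot_module poly3_ring I\<^esub> \<phi> p"
    and "\<And>p. p \<notin> I \<Longrightarrow> \<phi> p = undefined"
  shows "\<phi> \<in> carrier (tangent_space I)"
  using assms
  by (auto simp: tangent_space_def restrict_scalars_def hom_module_def ideal_module_def
      LinearCombinations.module_hom_def carrier_quot extensional_def class_ring_simps Pi_iff image_iff)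

lemma tangent_ops:
  assumes "p \<in> I"
  shows "(\<phi> \<oplus>\<^bsub>tangent_space I\<^esub> \<psi>) p = \<phi> p \<oplus>\<^bsub>quot_module poly3_ring I\<^esub> \<psi> p"
    and "(c \<odot>\<^bsub>tangent_space I\<^esub> \<phi>) p = const3 c \<odot>\<^bsub>quot_module poly3_ring I\<^esub> \<phi> p"
    and "\<zero>\<^bsub>tangent_space I\<^esub> p = I +>\<^bsub>poly3_ring\<^esub> 0"
  using assms
  by (auto simp: tangent_space_def restrict_scalars_def hom_module_def ideal_module_def zero_quot)

end

definition arrow_coeff ::
  "nat \<times> nat \<times> nat \<Rightarrow> nat \<times> nat \<times> nat \<Rightarrow> ('k::field poly3 \<Rightarrow> 'k poly3 set) \<Rightarrow> 'k" where
  "arrow_coeff \<beta> \<gamma> \<phi> = coset_coeff \<gamma> (\<phi> (monom3 \<beta>))"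

context monomial_ideal3
begin

lemma linear_form_arrow_coeff:
  assumes "\<beta> \<notin> std_exps I" "\<gamma> \<in> std_exps I"
  shows "linear_form (tangent_space I) (arrow_coeff \<beta> \<gamma>)"
proof -
  have \<beta>: "monom3 \<beta> \<in> I" using assms by (simp add: std_exps_def)
  show ?thesis
    unfolding linear_form_def arrow_coeff_def tangent_ops[OF \<beta>]
  proof (intro conjI ballI allI)
    fix \<phi> \<psi> assume "\<phi> \<in> carrier (tangent_space I)" "\<psi> \<in> carrier (tangent_space I)"
    then obtain p q where "\<phi> (monom3 \<beta>) = I +>\<^bsub>poly3_ring\<^esub> p" "\<psi> (monom3 \<beta>) = I +>\<^bsub>poly3_ring\<^esub> q"
      using tangentD(1) \<beta> by metis
    then show "coset_coeff \<gamma> (\<phi> (monom3 \<beta>) \<oplus>\<^bsub>quot_module poly3_ring I\<^esub> \<psi> (monom3 \<beta>))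
        = coset_coeff \<gamma> (\<phi> (monom3 \<beta>)) + coset_coeff \<gamma> (\<psi> (monom3 \<beta>))"
      using assms(2) by (simp add: add_quot coset_coeff_coset lookup_add)
  next
    fix c \<phi> assume "\<phi> \<in> carrier (tangent_space I)"
    then obtain p where "\<phi> (monom3 \<beta>) = I +>\<^bsub>poly3_ring\<^esub> p"
      using tangentD(1) \<beta> by metis
    then show "coset_coeff \<gamma> (const3 c \<odot>\<^bsub>quot_module poly3_ring I\<^esub> \<phi> (monom3 \<beta>))
        = c * coset_coeff \<gamma> (\<phi> (monom3 \<beta>))"
      using assms(2) by (simp add: smult_quot coset_coeff_coset lookup_const3_mult)
  qed
qed

lemma std_exps_add: "\<delta> + \<gamma> \<in> std_exps I \<Longrightarrow> \<gamma> \<in> std_exps I"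
  using mem_mult[of "monom3 \<gamma>" "monom3 \<delta>"] by (auto simp: std_exps_def monom3_mult)

text \<open>By S-linearity the value of \<phi> at the product is x^\<delta> times its value at
  x^\<beta>. These two rules yield \<open>N_up\<close> and \<open>N_down\<close> of
  \<open>arrow_system\<close>.\<close>

lemma arrow_coeff_shift:
  assumes \<phi>: "\<phi> \<in> carrier (tangent_space I)" and \<beta>: "\<beta> \<notin> std_exps I"
  shows "\<delta> + \<gamma> \<in> std_exps I \<Longrightarrow> arrow_coeff (\<delta> + \<beta>) (\<delta> + \<gamma>) \<phi> = arrow_coeff \<beta> \<gamma> \<phi>"
    and "\<epsilon> \<in> std_exps I \<Longrightarrow> (\<And>\<gamma>. \<epsilon> \<noteq> \<delta> + \<gamma>) \<Longrightarrow> arrow_coeff (\<delta> + \<beta>) \<epsilon> \<phi> = 0"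
proof -
  have mem: "monom3 \<beta> \<in> I" using \<beta> by (simp add: std_exps_def)
  obtain p where p: "\<phi> (monom3 \<beta>) = I +>\<^bsub>poly3_ring\<^esub> p" using tangentD(1)[OF \<phi> mem] by blast
  have shift: "\<phi> (monom3 (\<delta> + \<beta>)) = I +>\<^bsub>poly3_ring\<^esub> (monom3 \<delta> * p)"
    using tangentD(3)[OF \<phi> mem, of "monom3 \<delta>"] by (simp add: p smult_quot monom3_mult)
  show "\<delta> + \<gamma> \<in> std_exps I \<Longrightarrow> arrow_coeff (\<delta> + \<beta>) (\<delta> + \<gamma>) \<phi> = arrow_coeff \<beta> \<gamma> \<phi>"
    using std_exps_add[of \<delta> \<gamma>]
    by (simp add: arrow_coeff_def shift p coset_coeff_coset lookup_monom3_mult)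
  show "\<epsilon> \<in> std_exps I \<Longrightarrow> (\<And>\<gamma>. \<epsilon> \<noteq> \<delta> + \<gamma>) \<Longrightarrow> arrow_coeff (\<delta> + \<beta>) \<epsilon> \<phi> = 0"
    by (simp add: arrow_coeff_def shift coset_coeff_coset lookup_monom3_mult(2))
qed

text \<open>The monomials in \<open>I\<close> span it over k, and outside \<open>I\<close> both maps
  are \<open>undefined\<close>.\<close>

lemma tangent_eq_zero:
  assumes \<phi>: "\<phi> \<in> carrier (tangent_space I)"
    and zero: "\<And>\<beta> \<gamma>. \<beta> \<notin> std_exps I \<Longrightarrow> \<gamma> \<in> std_exps I \<Longrightarrow> arrow_coeff \<beta> \<gamma> \<phi> = 0"
  shows "\<phi> = \<zero>\<^bsub>tangent_space I\<^esub>"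
proof
  fix p
  have monom: "\<phi> (monom3 \<beta>) = I +>\<^bsub>poly3_ring\<^esub> 0" if \<beta>: "monom3 \<beta> \<in> I" for \<beta>
  proof -
    obtain q where q: "\<phi> (monom3 \<beta>) = I +>\<^bsub>poly3_ring\<^esub> q" using tangentD(1)[OF \<phi> \<beta>] by blast
    show ?thesis unfolding q
    proof (rule coset_eqI)
      fix \<gamma> assume \<gamma>: "\<gamma> \<in> std_exps I"
      then have "arrow_coeff \<beta> \<gamma> \<phi> = 0" using \<beta> by (intro zero) (auto simp: std_exps_def)
      then show "Poly_Mapping.lookup q \<gamma> = Poly_Mapping.lookup 0 \<gamma>"
        using \<gamma> by (simp add: arrow_coeff_def q coset_coeff_coset)
    qed
  qed
  have sum: "\<phi> (\<Sum>\<beta>\<in>F. const3 (Poly_Mapping.lookup p \<beta>) * monom3 \<beta>) = I +>\<^bsub>poly3_ring\<^esub> 0"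
    if "finite F" "\<And>\<beta>. \<beta> \<in> F \<Longrightarrow> monom3 \<beta> \<in> I" for F
    using that
  proof (induction F)
    case empty
    have "\<phi> (0 * 0) = I +>\<^bsub>poly3_ring\<^esub> 0"
      using tangentD(1)[OF \<phi> mem_zero] tangentD(3)[OF \<phi> mem_zero, of 0] by (auto simp: smult_quot)
    then show ?case by simp
  next
    case (insert \<beta> F)
    have "(\<Sum>\<beta>\<in>F. const3 (Poly_Mapping.lookup p \<beta>) * monom3 \<beta>) \<in> I"
      using insert.prems by (intro mem_sum mem_mult) auto
    moreover have "monom3 \<beta> \<in> I" using insert.prems by simp
    ultimately show ?case
      using insert monom[of \<beta>]
      by (simp add: tangentD(2,3)[OF \<phi>] mem_mult add_quot smult_quot)
  qed
  show "\<phi> p = \<zero>\<^bsub>tangent_space I\<^esub> p"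
  proof (cases "p \<in> I")
    case True
    then show ?thesis
      using sum[of "Poly_Mapping.keys p"] monom3_key_mem
      by (simp add: tangent_ops const3_mult_monom3 sum_single_lookup)
  next
    case False
    then show ?thesis using tangentD(4)[OF \<phi>]
      by (simp add: tangent_space_def restrict_scalars_def hom_module_def ideal_module_def)
  qed
qed

lemma tangent_component_subset: "tangent_component I \<alpha> \<subseteq> carrier (tangent_space I)"
  by (auto simp: tangent_component_def)

lemma arrow_coeff_component:
  assumes "\<phi> \<in> tangent_component I \<alpha>" "\<beta> \<notin> std_exps I" "\<gamma> \<in> std_exps I" "arrow_coeff \<beta> \<gamma> \<phi> \<noteq> 0"
  shows "\<alpha> = int3 \<gamma> - int3 \<beta>"
proof -
  have "\<phi> (monom3 \<beta>) \<in> quot_component I (\<alpha> + int3 \<beta>)"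
    using assms(1,2) unfolding tangent_component_def std_exps_def by blast
  then obtain p where p: "p \<in> poly_component (\<alpha> + int3 \<beta>)" "\<phi> (monom3 \<beta>) = I +>\<^bsub>poly3_ring\<^esub> p"
    unfolding quot_component_def by blast
  then have "\<gamma> \<in> Poly_Mapping.keys p"
    using assms(3,4) by (simp add: arrow_coeff_def coset_coeff_coset in_keys_iff)
  with p(1) have "int3 \<gamma> = \<alpha> + int3 \<beta>" by (simp add: poly_component_def)
  then show ?thesis by simp
qed

lemma vectorspace_signature: "class_vectorspace (tangent_signature s I)"
proof -
  interpret T: class_vectorspace "tangent_space I" by (rule vectorspace_tangent)
  have "(\<Union>\<alpha>\<in>{\<alpha>. has_signature s \<alpha>}. tangent_component I \<alpha>) \<subseteq> carrier (tangent_space I)"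
    using tangent_component_subset by blast
  from T.subspace_is_vs[OF T.span_is_subspace[OF this]] show ?thesis
    by (simp add: class_vectorspace_def tangent_signature_def)
qed

lemma signature_carrier:
  "carrier (tangent_signature s I) \<subseteq> carrier (tangent_space I)"
  "has_signature s \<alpha> \<Longrightarrow> tangent_component I \<alpha> \<subseteq> carrier (tangent_signature s I)"
proof -
  interpret T: class_vectorspace "tangent_space I" by (rule vectorspace_tangent)
  have sub: "(\<Union>\<alpha>\<in>{\<alpha>. has_signature s \<alpha>}. tangent_component I \<alpha>) \<subseteq> carrier (tangent_space I)"
    using tangent_component_subset by blast
  show "carrier (tangent_signature s I) \<subseteq> carrier (tangent_space I)"
    using T.span_is_subset2[OF sub] by (simp add: tangent_signature_def)
  show "has_signature s \<alpha> \<Longrightarrow> tangent_component I \<alpha> \<subseteq> carrier (tangent_signature s I)"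
    using T.in_own_span[OF sub] by (auto simp: tangent_signature_def)
qed

text \<open>The vanishing of one arrow defines a subspace. If the degree of the arrow does not fit
  \<open>s\<close>, this subspace contains all components of signature \<open>s\<close>, hence their
  span.\<close>

lemma arrow_coeff_signature:
  assumes "\<phi> \<in> carrier (tangent_signature s I)" "\<beta> \<notin> std_exps I" "\<gamma> \<in> std_exps I"
    "arrow_coeff \<beta> \<gamma> \<phi> \<noteq> 0"
  shows "has_signature s (int3 \<gamma> - int3 \<beta>)"
proof (rule ccontr)
  assume no: "\<not> ?thesis"
  interpret T: class_vectorspace "tangent_space I" by (rule vectorspace_tangent)
  \<comment> \<open>The dummy singleton turns one form into a family, as the kernel lemma
    expects.\<close>
  have "submodule base_field {\<phi> \<in> carrier (tangent_space I). \<forall>e\<in>{()}. arrow_coeff \<beta> \<gamma> \<phi> = 0} (tangent_space I)"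
    by (rule T.submodule_kernel) (use assms in \<open>simp add: linear_form_arrow_coeff\<close>)
  moreover have "(\<Union>\<alpha>\<in>{\<alpha>. has_signature s \<alpha>}. tangent_component I \<alpha>)
      \<subseteq> {\<phi> \<in> carrier (tangent_space I). \<forall>e\<in>{()}. arrow_coeff \<beta> \<gamma> \<phi> = 0}"
  proof
    fix \<psi> assume "\<psi> \<in> (\<Union>\<alpha>\<in>{\<alpha>. has_signature s \<alpha>}. tangent_component I \<alpha>)"
    then obtain \<alpha> where \<alpha>: "has_signature s \<alpha>" "\<psi> \<in> tangent_component I \<alpha>" by blast
    then have "arrow_coeff \<beta> \<gamma> \<psi> = 0"
      using no arrow_coeff_component[OF \<alpha>(2) assms(2,3)] by metis
    then show "\<psi> \<in> {\<phi> \<in> carrier (tangent_space I). \<forall>e\<in>{()}. arrow_coeff \<beta> \<gamma> \<phi> = 0}"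
      using \<alpha>(2) tangent_component_subset by blast
  qed
  ultimately have "carrier (tangent_signature s I)
      \<subseteq> {\<phi> \<in> carrier (tangent_space I). \<forall>e\<in>{()}. arrow_coeff \<beta> \<gamma> \<phi> = 0}"
    using T.span_is_subset by (simp add: tangent_signature_def)
  with assms show False by auto
qed

lemma linear_form_signature:
  assumes "\<beta> \<notin> std_exps I" "\<gamma> \<in> std_exps I"
  shows "linear_form (tangent_signature s I) (arrow_coeff \<beta> \<gamma>)"
proof -
  have ops: "add (tangent_signature s I) = add (tangent_space I)"
    "module.smult (tangent_signature s I) = module.smult (tangent_space I)"
    by (simp_all add: tangent_signature_def)
  show ?thesis
    unfolding linear_form_def ops
    using linear_formD[OF linear_form_arrow_coeff[OF assms]] signature_carrier(1)[of s] by blast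
qed

end

section \<open>The exchange of y and z, and the upper bounds\<close>

text \<open>The flag lets one argument serve two signatures. The exchange does not preserve
  \<open>borel3\<close>, but the arrow bounds rest on finiteness and downward closure, which it
  preserves, and it fixes the first exponent.\<close>

fun swap_yz :: "bool \<Rightarrow> nat \<times> nat \<times> nat \<Rightarrow> nat \<times> nat \<times> nat" where
  "swap_yz \<sigma> (a, b, c) = (if \<sigma> then (a, c, b) else (a, b, c))"

lemma swap_yz_swap [simp]: "swap_yz \<sigma> (swap_yz \<sigma> t) = t"
  by (cases t) simp

lemma swap_yz_eq_iff [simp]: "swap_yz \<sigma> t = swap_yz \<sigma> u \<longleftrightarrow> t = u"
  by (metis swap_yz_swap)

lemma swap_yz_add: "swap_yz \<sigma> (t + u) = swap_yz \<sigma> t + swap_yz \<sigma> u"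
  by (cases t; cases u) simp

lemma fst_swap_yz [simp]: "fst (swap_yz \<sigma> t) = fst t"
  by (cases t) simp

lemma vimage_swap_yz: "swap_yz \<sigma> -` B = swap_yz \<sigma> ` B"
  by (force simp: image_iff)

lemma sum_vimage_swap_yz: "(\<Sum>t\<in>swap_yz \<sigma> -` B. f (fst t)) = (\<Sum>t\<in>B. f (fst t))"
  unfolding vimage_swap_yz by (subst sum.reindex) (auto simp: inj_on_def)

context monomial_ideal3
begin

text \<open>The membership conditions belong to the relation because \<open>arrow_coeff\<close> has
  a meaning only for arrows from the ideal to its complement.\<close>

lemma arrow_system_tangent:
  assumes fin: "finite (std_exps I)" and \<phi>: "\<phi> \<in> carrier (tangent_space I)"
  shows "arrow_system (swap_yz \<sigma> -` std_exps I)
    (\<lambda>t u. swap_yz \<sigma> t \<notin> std_exps I \<and> swap_yz \<sigma> u \<in> std_exps I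
       \<and> arrow_coeff (swap_yz \<sigma> t) (swap_yz \<sigma> u) \<phi> \<noteq> 0)"
proof
  show "finite (swap_yz \<sigma> -` std_exps I)" using fin by (simp add: vimage_swap_yz)
next
  fix t u \<delta>
  assume "swap_yz \<sigma> t \<notin> std_exps I \<and> swap_yz \<sigma> u \<in> std_exps I
       \<and> arrow_coeff (swap_yz \<sigma> t) (swap_yz \<sigma> u) \<phi> \<noteq> 0"
    and "\<delta> + u \<in> swap_yz \<sigma> -` std_exps I"
  then show "swap_yz \<sigma> (\<delta> + t) \<notin> std_exps I \<and> swap_yz \<sigma> (\<delta> + u) \<in> std_exps I
       \<and> arrow_coeff (swap_yz \<sigma> (\<delta> + t)) (swap_yz \<sigma> (\<delta> + u)) \<phi> \<noteq> 0"
    using std_exps_add[of "swap_yz \<sigma> \<delta>" "swap_yz \<sigma> t"]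
    by (auto simp: swap_yz_add arrow_coeff_shift[OF \<phi>])
next
  fix t u \<delta>
  assume *: "swap_yz \<sigma> (\<delta> + t) \<notin> std_exps I \<and> swap_yz \<sigma> u \<in> std_exps I
       \<and> arrow_coeff (swap_yz \<sigma> (\<delta> + t)) (swap_yz \<sigma> u) \<phi> \<noteq> 0"
    and t: "t \<notin> swap_yz \<sigma> -` std_exps I"
  then have t': "swap_yz \<sigma> t \<notin> std_exps I" by simp
  obtain \<gamma> where \<gamma>: "swap_yz \<sigma> u = swap_yz \<sigma> \<delta> + \<gamma>"
    using arrow_coeff_shift(2)[OF \<phi> t', of "swap_yz \<sigma> u" "swap_yz \<sigma> \<delta>"] *
    by (auto simp: swap_yz_add)
  then have u: "u = \<delta> + swap_yz \<sigma> \<gamma>"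
    by (metis swap_yz_add swap_yz_swap)
  show "\<exists>u'. u = \<delta> + u' \<and> swap_yz \<sigma> t \<notin> std_exps I \<and> swap_yz \<sigma> u' \<in> std_exps I
       \<and> arrow_coeff (swap_yz \<sigma> t) (swap_yz \<sigma> u') \<phi> \<noteq> 0"
    using * t' std_exps_add[of "swap_yz \<sigma> \<delta>" \<gamma>] arrow_coeff_shift(1)[OF \<phi> t', of "swap_yz \<sigma> \<delta>" \<gamma>]
    by (intro exI[of _ "swap_yz \<sigma> \<gamma>"]) (simp add: u swap_yz_add)
qed auto

text \<open>\<open>E\<close> lists arrows in exchanged coordinates. By
  \<open>tangent_eq_zero\<close> a nonzero tangent vector has a nonzero arrow, and
  \<open>sep\<close> moves it into \<open>E\<close>, so the coefficients along \<open>E\<close>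
  separate.\<close>

lemma dim_signature_le:
  assumes fin: "finite E"
    and E: "\<And>t u. (t, u) \<in> E \<Longrightarrow> swap_yz \<sigma> t \<notin> std_exps I \<and> swap_yz \<sigma> u \<in> std_exps I"
    and sep: "\<And>\<phi> \<beta> \<gamma>. \<phi> \<in> carrier (tangent_signature s I) \<Longrightarrow> \<beta> \<notin> std_exps I \<Longrightarrow> \<gamma> \<in> std_exps I
        \<Longrightarrow> arrow_coeff \<beta> \<gamma> \<phi> \<noteq> 0
        \<Longrightarrow> \<exists>e\<in>E. arrow_coeff (swap_yz \<sigma> (fst e)) (swap_yz \<sigma> (snd e)) \<phi> \<noteq> 0"
  shows "vectorspace.fin_dim base_field (tangent_signature s I)"
    and "vectorspace.dim base_field (tangent_signature s I) \<le> card E"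
proof -
  interpret V: class_vectorspace "tangent_signature s I" by (rule vectorspace_signature)
  have form: "linear_form (tangent_signature s I)
      (arrow_coeff (swap_yz \<sigma> (fst e)) (swap_yz \<sigma> (snd e)))" if "e \<in> E" for e
    using E[of "fst e" "snd e"] that by (intro linear_form_signature) auto
  have zero: "\<phi> = \<zero>\<^bsub>tangent_signature s I\<^esub>"
    if \<phi>: "\<phi> \<in> carrier (tangent_signature s I)"
      and "\<And>e. e \<in> E \<Longrightarrow> arrow_coeff (swap_yz \<sigma> (fst e)) (swap_yz \<sigma> (snd e)) \<phi> = 0" for \<phi>
  proof -
    have "\<phi> = \<zero>\<^bsub>tangent_space I\<^esub>"
      using \<phi> signature_carrier(1) sep[OF \<phi>] that(2) by (intro tangent_eq_zero) blast+
    then show ?thesis by (simp add: tangent_signature_def)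
  qed
  note dims = V.dim_le_card_separating[of E
      "\<lambda>e. arrow_coeff (swap_yz \<sigma> (fst e)) (swap_yz \<sigma> (snd e))", OF fin form zero]
  show "V.fin_dim" by (rule dims(1))
  show "V.dim \<le> card E" by (rule dims(2))
qed

end

definition sig_ppn :: "bool \<Rightarrow> letter \<times> letter \<times> letter" where
  "sig_ppn \<sigma> = (if \<sigma> then (Pos, Neg, Pos) else (Pos, Pos, Neg))"

definition sig_nnp :: "bool \<Rightarrow> letter \<times> letter \<times> letter" where
  "sig_nnp \<sigma> = (if \<sigma> then (Neg, Pos, Neg) else (Neg, Neg, Pos))"

lemma has_sig_ppn:
  "has_signature (sig_ppn \<sigma>) (int3 (swap_yz \<sigma> (g1, g2, g3)) - int3 (swap_yz \<sigma> (b1, b2, b3)))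
     \<longleftrightarrow> b1 \<le> g1 \<and> b2 \<le> g2 \<and> g3 < b3"
  by (auto simp: sig_ppn_def)

lemma has_sig_nnp:
  "has_signature (sig_nnp \<sigma>) (int3 (swap_yz \<sigma> (g1, g2, g3)) - int3 (swap_yz \<sigma> (b1, b2, b3)))
     \<longleftrightarrow> g1 < b1 \<and> g2 < b2 \<and> b3 \<le> g3"
  by (auto simp: sig_nnp_def)

context monomial_ideal3
begin

lemma vimage_std_exps_down:
  "(a, b, c) \<in> swap_yz \<sigma> -` std_exps I \<Longrightarrow> a' \<le> a \<Longrightarrow> b' \<le> b \<Longrightarrow> c' \<le> c
     \<Longrightarrow> (a', b', c') \<in> swap_yz \<sigma> -` std_exps I"
  by (auto elim: std_exps_down split: if_splits)

lemma dim_sig_ppn_le: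
  assumes fin: "finite (std_exps I)"
  shows "vectorspace.fin_dim base_field (tangent_signature (sig_ppn \<sigma>) I)"
    and "vectorspace.dim base_field (tangent_signature (sig_ppn \<sigma>) I) \<le> (\<Sum>\<gamma>\<in>std_exps I. Suc (fst \<gamma>))"
proof -
  define B where "B = swap_yz \<sigma> -` std_exps I"
  have finB: "finite B" using fin by (simp add: B_def vimage_swap_yz)
  have down: "(a, b, c) \<in> B \<Longrightarrow> a' \<le> a \<Longrightarrow> b' \<le> b \<Longrightarrow> c' \<le> c \<Longrightarrow> (a', b', c') \<in> B" for a b c a' b' c'
    unfolding B_def by (rule vimage_std_exps_down)
  define E where "E = {((b1, b2, b3), (g1, g2, g3)). (g1, g2, g3) \<in> B \<and> (g1, Suc g2, g3) \<notin> B
       \<and> (b1, b2, b3) \<notin> B \<and> (b1, b2, b3 - 1) \<in> B \<and> b1 \<le> g1 \<and> b2 \<le> g2 \<and> g3 < b3}"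
  have E: "finite E" "card E \<le> (\<Sum>t\<in>B. Suc (fst t))"
    unfolding E_def by (rule card_arrows_ppn[OF finB]; erule (3) down)+
  have EB: "swap_yz \<sigma> t \<notin> std_exps I \<and> swap_yz \<sigma> u \<in> std_exps I" if "(t, u) \<in> E" for t u
  proof -
    have "t \<notin> B \<and> u \<in> B" using that by (auto simp: E_def)
    then show ?thesis by (simp add: B_def)
  qed
  have sep: "\<exists>e\<in>E. arrow_coeff (swap_yz \<sigma> (fst e)) (swap_yz \<sigma> (snd e)) \<phi> \<noteq> 0"
    if \<phi>: "\<phi> \<in> carrier (tangent_signature (sig_ppn \<sigma>) I)" and "\<beta> \<notin> std_exps I" "\<gamma> \<in> std_exps I"
      "arrow_coeff \<beta> \<gamma> \<phi> \<noteq> 0" for \<phi> \<beta> \<gamma>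
  proof -
    have "\<phi> \<in> carrier (tangent_space I)" using \<phi> signature_carrier(1) by blast
    then interpret arrow_system B "\<lambda>t u. swap_yz \<sigma> t \<notin> std_exps I \<and> swap_yz \<sigma> u \<in> std_exps I
       \<and> arrow_coeff (swap_yz \<sigma> t) (swap_yz \<sigma> u) \<phi> \<noteq> 0"
      unfolding B_def by (rule arrow_system_tangent[OF fin])
    have "\<exists>e\<in>E. swap_yz \<sigma> (fst e) \<notin> std_exps I \<and> swap_yz \<sigma> (snd e) \<in> std_exps I
       \<and> arrow_coeff (swap_yz \<sigma> (fst e)) (swap_yz \<sigma> (snd e)) \<phi> \<noteq> 0"
      unfolding E_def
    proof (rule ex_arrow_ppn)
      show "swap_yz \<sigma> (swap_yz \<sigma> \<beta>) \<notin> std_exps I \<and> swap_yz \<sigma> (swap_yz \<sigma> \<gamma>) \<in> std_exps I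
         \<and> arrow_coeff (swap_yz \<sigma> (swap_yz \<sigma> \<beta>)) (swap_yz \<sigma> (swap_yz \<sigma> \<gamma>)) \<phi> \<noteq> 0"
        using that by simp
    next
      fix b1 b2 b3 g1 g2 g3 :: nat
      let ?t = "swap_yz \<sigma> (b1, b2, b3)" and ?u = "swap_yz \<sigma> (g1, g2, g3)"
      assume "?t \<notin> std_exps I \<and> ?u \<in> std_exps I \<and> arrow_coeff ?t ?u \<phi> \<noteq> 0"
      then have "has_signature (sig_ppn \<sigma>) (int3 ?u - int3 ?t)"
        by (intro arrow_coeff_signature[OF \<phi>]) (elim conjE, assumption)+
      then show "b1 \<le> g1 \<and> b2 \<le> g2 \<and> g3 < b3"
        by (simp only: has_sig_ppn)
    qed
    then show ?thesis by blast
  qed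
  show "vectorspace.fin_dim base_field (tangent_signature (sig_ppn \<sigma>) I)"
    by (rule dim_signature_le(1)[OF E(1) EB sep])
  have ppn: "vectorspace.dim base_field (tangent_signature (sig_ppn \<sigma>) I) \<le> card E"
    by (rule dim_signature_le(2)[OF E(1) EB sep])
  with E(2) show "vectorspace.dim base_field (tangent_signature (sig_ppn \<sigma>) I)
      \<le> (\<Sum>\<gamma>\<in>std_exps I. Suc (fst \<gamma>))"
    unfolding B_def sum_vimage_swap_yz by simp
qed

lemma dim_sig_nnp_le:
  assumes fin: "finite (std_exps I)"
  shows "vectorspace.fin_dim base_field (tangent_signature (sig_nnp \<sigma>) I)"
    and "vectorspace.dim base_field (tangent_signature (sig_nnp \<sigma>) I) \<le> (\<Sum>\<gamma>\<in>std_exps I. fst \<gamma>)"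
proof -
  define B where "B = swap_yz \<sigma> -` std_exps I"
  have finB: "finite B" using fin by (simp add: B_def vimage_swap_yz)
  have down: "(a, b, c) \<in> B \<Longrightarrow> a' \<le> a \<Longrightarrow> b' \<le> b \<Longrightarrow> c' \<le> c \<Longrightarrow> (a', b', c') \<in> B" for a b c a' b' c'
    unfolding B_def by (rule vimage_std_exps_down)
  define E where "E = {((b1, b2, b3), (g1, g2, g3)). (g1, g2, g3) \<in> B \<and> (g1, g2, Suc g3) \<notin> B
       \<and> (b1, b2, b3) \<notin> B \<and> (b1, b2 - 1, b3) \<in> B \<and> g1 < b1 \<and> g2 < b2 \<and> b3 \<le> g3}"
  have E: "finite E" "card E \<le> (\<Sum>t\<in>B. fst t)"
    unfolding E_def by (rule card_arrows_nnp[OF finB]; erule (3) down)+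
  have EB: "swap_yz \<sigma> t \<notin> std_exps I \<and> swap_yz \<sigma> u \<in> std_exps I" if "(t, u) \<in> E" for t u
  proof -
    have "t \<notin> B \<and> u \<in> B" using that by (auto simp: E_def)
    then show ?thesis by (simp add: B_def)
  qed
  have sep: "\<exists>e\<in>E. arrow_coeff (swap_yz \<sigma> (fst e)) (swap_yz \<sigma> (snd e)) \<phi> \<noteq> 0"
    if \<phi>: "\<phi> \<in> carrier (tangent_signature (sig_nnp \<sigma>) I)" and "\<beta> \<notin> std_exps I" "\<gamma> \<in> std_exps I"
      "arrow_coeff \<beta> \<gamma> \<phi> \<noteq> 0" for \<phi> \<beta> \<gamma>
  proof -
    have "\<phi> \<in> carrier (tangent_space I)" using \<phi> signature_carrier(1) by blast
    then interpret arrow_system B "\<lambda>t u. swap_yz \<sigma> t \<notin> std_exps I \<and> swap_yz \<sigma> u \<in> std_exps I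
       \<and> arrow_coeff (swap_yz \<sigma> t) (swap_yz \<sigma> u) \<phi> \<noteq> 0"
      unfolding B_def by (rule arrow_system_tangent[OF fin])
    have "\<exists>e\<in>E. swap_yz \<sigma> (fst e) \<notin> std_exps I \<and> swap_yz \<sigma> (snd e) \<in> std_exps I
       \<and> arrow_coeff (swap_yz \<sigma> (fst e)) (swap_yz \<sigma> (snd e)) \<phi> \<noteq> 0"
      unfolding E_def
    proof (rule ex_arrow_nnp)
      show "swap_yz \<sigma> (swap_yz \<sigma> \<beta>) \<notin> std_exps I \<and> swap_yz \<sigma> (swap_yz \<sigma> \<gamma>) \<in> std_exps I
         \<and> arrow_coeff (swap_yz \<sigma> (swap_yz \<sigma> \<beta>)) (swap_yz \<sigma> (swap_yz \<sigma> \<gamma>)) \<phi> \<noteq> 0"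
        using that by simp
    next
      fix b1 b2 b3 g1 g2 g3 :: nat
      let ?t = "swap_yz \<sigma> (b1, b2, b3)" and ?u = "swap_yz \<sigma> (g1, g2, g3)"
      assume "?t \<notin> std_exps I \<and> ?u \<in> std_exps I \<and> arrow_coeff ?t ?u \<phi> \<noteq> 0"
      then have "has_signature (sig_nnp \<sigma>) (int3 ?u - int3 ?t)"
        by (intro arrow_coeff_signature[OF \<phi>]) (elim conjE, assumption)+
      then show "g1 < b1 \<and> g2 < b2 \<and> b3 \<le> g3"
        by (simp only: has_sig_nnp)
    qed
    then show ?thesis by blast
  qed
  show "vectorspace.fin_dim base_field (tangent_signature (sig_nnp \<sigma>) I)"
    by (rule dim_signature_le(1)[OF E(1) EB sep])
  have "vectorspace.dim base_field (tangent_signature (sig_nnp \<sigma>) I) \<le> card E"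
    by (rule dim_signature_le(2)[OF E(1) EB sep])
  with E(2) show "vectorspace.dim base_field (tangent_signature (sig_nnp \<sigma>) I)
      \<le> (\<Sum>\<gamma>\<in>std_exps I. fst \<gamma>)"
    using sum_vimage_swap_yz[of "\<lambda>n. n"] by (simp add: B_def)
qed

end

section \<open>Tangent vectors attaining the bounds at powers of the maximal ideal\<close>

text \<open>The k-linear map taking x^\<beta> to the coset of x^\<gamma> and the other monomials of
  the ideal to zero; it is S-linear when \<beta> has degree r and \<gamma> degree r - 1.\<close>

definition arrow_map ::
  "nat \<Rightarrow> nat \<times> nat \<times> nat \<Rightarrow> nat \<times> nat \<times> nat \<Rightarrow> 'k::field poly3 \<Rightarrow> 'k poly3 set" where
  "arrow_map r \<beta> \<gamma> = (\<lambda>p\<in>degree_ge r.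
     degree_ge r +>\<^bsub>poly3_ring\<^esub> Poly_Mapping.single \<gamma> (Poly_Mapping.lookup p \<beta>))"

text \<open>All monomials of p have degree at least a + b + c, so only the constant term of q
  contributes in this lowest degree.\<close>

lemma lookup_mult_degree_ge:
  assumes "p \<in> degree_ge (a + b + c)"
  shows "Poly_Mapping.lookup (q * p) (a, b, c)
    = Poly_Mapping.lookup q (0, 0, 0) * Poly_Mapping.lookup p (a, b, c)"
proof -
  let ?q = "\<lambda>\<delta>. const3 (Poly_Mapping.lookup q \<delta>) * monom3 \<delta>"
  have "Poly_Mapping.lookup (monom3 \<delta> * p) (a, b, c) = 0" if "\<delta> \<noteq> (0, 0, 0)" for \<delta>
  proof (cases "\<exists>\<gamma>. (a, b, c) = \<delta> + \<gamma>")
    case True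
    then obtain a' b' c' where \<gamma>: "(a, b, c) = \<delta> + (a', b', c')" by (metis prod_cases3)
    then have "a' + b' + c' < a + b + c" using that by (cases \<delta>) auto
    then have "(a', b', c') \<notin> Poly_Mapping.keys p" using assms by (auto simp: degree_ge_def)
    then show ?thesis unfolding \<gamma> lookup_monom3_mult by (simp add: in_keys_iff)
  qed (use lookup_monom3_mult(2) in blast)
  then have nz: "Poly_Mapping.lookup (?q \<delta> * p) (a, b, c) = 0" if "\<delta> \<noteq> (0, 0, 0)" for \<delta>
    using that by (simp add: mult.assoc lookup_const3_mult)
  have "q * p = (\<Sum>\<delta>\<in>Poly_Mapping.keys q. ?q \<delta> * p)"
    unfolding sum_distrib_right[symmetric] const3_mult_monom3 sum_single_lookup ..
  then have "Poly_Mapping.lookup (q * p) (a, b, c)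
      = (\<Sum>\<delta>\<in>Poly_Mapping.keys q. Poly_Mapping.lookup (?q \<delta> * p) (a, b, c))"
    by (simp add: lookup_sum)
  also have "\<dots> = (\<Sum>\<delta>\<in>Poly_Mapping.keys q. if \<delta> = (0, 0, 0)
      then Poly_Mapping.lookup q (0, 0, 0) * Poly_Mapping.lookup p (a, b, c) else 0)"
    using nz by (intro sum.cong) (auto simp: const3_mult_monom3 lookup_const3_mult[unfolded const3_def])
  also have "\<dots> = Poly_Mapping.lookup q (0, 0, 0) * Poly_Mapping.lookup p (a, b, c)"
    by (auto simp: in_keys_iff)
  finally show ?thesis .
qed

text \<open>In the S-linearity only the constant term of q acts on both sides: on p because \<beta>
  has the lowest degree r, and on x^\<gamma> because its proper multiples have degree at least r and
  vanish in the quotient.\<close>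

lemma arrow_map_component:
  fixes b1 b2 b3 g1 g2 g3 :: nat
  assumes "b1 + b2 + b3 = r" "Suc (g1 + g2 + g3) = r"
  shows "(arrow_map r (b1, b2, b3) (g1, g2, g3) :: 'k::field poly3 \<Rightarrow> _)
    \<in> tangent_component (degree_ge r) (int3 (g1, g2, g3) - int3 (b1, b2, b3))"
proof -
  let ?I = "degree_ge r :: 'k poly3 set"
  let ?\<beta> = "(b1, b2, b3)" and ?\<gamma> = "(g1, g2, g3)"
  let ?\<phi> = "arrow_map r ?\<beta> ?\<gamma> :: 'k poly3 \<Rightarrow> _"
  interpret monomial_ideal3 ?I by (rule monomial_ideal3_degree_ge)
  have "?\<phi> \<in> carrier (tangent_space ?I)"
  proof (rule tangentI)
    fix p q assume pq: "p \<in> ?I" "q \<in> ?I"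
    then show "?\<phi> (p + q) = ?\<phi> p \<oplus>\<^bsub>quot_module poly3_ring ?I\<^esub> ?\<phi> q"
      by (simp add: arrow_map_def mem_add add_quot lookup_add single_add)
  next
    fix p q assume p: "p \<in> ?I"
    have "Poly_Mapping.lookup (q * p) ?\<beta> = Poly_Mapping.lookup q (0, 0, 0) * Poly_Mapping.lookup p ?\<beta>"
      using p assms(1) by (intro lookup_mult_degree_ge) simp
    moreover have "?I +>\<^bsub>poly3_ring\<^esub> Poly_Mapping.single ?\<gamma> (Poly_Mapping.lookup q (0, 0, 0) * c)
        = ?I +>\<^bsub>poly3_ring\<^esub> (q * Poly_Mapping.single ?\<gamma> c)" for c
    proof (rule coset_eqI)
      fix \<delta> assume \<delta>: "\<delta> \<in> std_exps ?I"
      show "Poly_Mapping.lookup (Poly_Mapping.single ?\<gamma> (Poly_Mapping.lookup q (0, 0, 0) * c)) \<delta>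
          = Poly_Mapping.lookup (q * Poly_Mapping.single ?\<gamma> c) \<delta>"
      proof (cases "\<exists>\<epsilon>. \<delta> = ?\<gamma> + \<epsilon>")
        case True
        then obtain \<epsilon> where \<epsilon>: "\<delta> = ?\<gamma> + \<epsilon>" by blast
        then have "\<epsilon> = (0, 0, 0)"
          using \<delta> assms(2) by (cases \<epsilon>) (auto simp: std_exps_degree_ge simplex_def)
        with \<epsilon> show ?thesis
          using lookup_single_mult(1)[of ?\<gamma> c q "(0, 0, 0)"] by (simp add: mult.commute)
      next
        case False
        then have "\<delta> \<noteq> ?\<gamma>" by (metis add.right_neutral)
        then show ?thesis
          using False lookup_single_mult(2)[of \<delta> ?\<gamma> c q] by (auto simp: mult.commute lookup_single)
      qed
    qed
    ultimately show "?\<phi> (q * p) = q \<odot>\<^bsub>quot_module poly3_ring ?I\<^esub> ?\<phi> p"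
      using p by (simp add: arrow_map_def mem_mult smult_quot)
  qed (auto simp: arrow_map_def)
  moreover have "?\<phi> (monom3 \<beta>) \<in> quot_component ?I (int3 ?\<gamma> - int3 ?\<beta> + int3 \<beta>)"
    if "monom3 \<beta> \<in> ?I" for \<beta>
    using that
    by (auto simp: arrow_map_def quot_component_def poly_component_def monom3_def lookup_single
        when_def intro!: imageI)
  ultimately show ?thesis unfolding tangent_component_def by blast
qed

text \<open>The maps \<open>arrow_map\<close> along \<open>E\<close> are dual to the arrow
  coefficients along \<open>E\<close>, and the degree conditions make \<open>E\<close>
  finite.\<close>

lemma card_le_dim_signature_degree_ge:
  fixes E :: "((nat \<times> nat \<times> nat) \<times> nat \<times> nat \<times> nat) set"
  assumes fin: "vectorspace.fin_dim base_field (tangent_signature s (degree_ge r :: 'k::field poly3 set))"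
    and E: "\<And>b1 b2 b3 g1 g2 g3. ((b1, b2, b3), (g1, g2, g3)) \<in> E \<Longrightarrow>
        b1 + b2 + b3 = r \<and> Suc (g1 + g2 + g3) = r
        \<and> has_signature s (int3 (swap_yz \<sigma> (g1, g2, g3)) - int3 (swap_yz \<sigma> (b1, b2, b3)))"
  shows "card E \<le> vectorspace.dim base_field (tangent_signature s (degree_ge r :: 'k poly3 set))"
proof -
  let ?I = "degree_ge r :: 'k poly3 set"
  interpret monomial_ideal3 ?I by (rule monomial_ideal3_degree_ge)
  interpret V: class_vectorspace "tangent_signature s ?I" by (rule vectorspace_signature)
  have std: "swap_yz \<sigma> t \<notin> std_exps ?I" "swap_yz \<sigma> u \<in> std_exps ?I"
    and comp: "(arrow_map r (swap_yz \<sigma> t) (swap_yz \<sigma> u) :: 'k poly3 \<Rightarrow> _) \<in> carrier (tangent_signature s ?I)"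
    if "(t, u) \<in> E" for t u
  proof -
    obtain b1 b2 b3 g1 g2 g3 where tu: "t = (b1, b2, b3)" "u = (g1, g2, g3)"
      by (metis prod_cases3)
    with E[of b1 b2 b3 g1 g2 g3] that have e: "b1 + b2 + b3 = r" "Suc (g1 + g2 + g3) = r"
      and s: "has_signature s (int3 (swap_yz \<sigma> u) - int3 (swap_yz \<sigma> t))"
      by auto
    show "swap_yz \<sigma> t \<notin> std_exps ?I" "swap_yz \<sigma> u \<in> std_exps ?I"
      using e by (auto simp: tu std_exps_degree_ge simplex_def)
    have "(arrow_map r (swap_yz \<sigma> t) (swap_yz \<sigma> u) :: 'k poly3 \<Rightarrow> _)
        \<in> tangent_component ?I (int3 (swap_yz \<sigma> u) - int3 (swap_yz \<sigma> t))"
      using e by (cases \<sigma>) (auto simp: tu simp del: int3.simps intro!: arrow_map_component)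
    then show "(arrow_map r (swap_yz \<sigma> t) (swap_yz \<sigma> u) :: 'k poly3 \<Rightarrow> _) \<in> carrier (tangent_signature s ?I)"
      using signature_carrier(2)[OF s] by blast
  qed
  have "finite E"
    by (rule finite_subset[of _ "({..r} \<times> {..r} \<times> {..r}) \<times> ({..r} \<times> {..r} \<times> {..r})"])
       (use E in fastforce)+
  then show ?thesis
    using fin
  proof (rule V.card_le_dim_dual)
    fix e assume "e \<in> E"
    then have e: "(fst e, snd e) \<in> E" by simp
    show "linear_form (tangent_signature s ?I) (arrow_coeff (swap_yz \<sigma> (fst e)) (swap_yz \<sigma> (snd e)))"
      using std[OF e] by (rule linear_form_signature)
    show "arrow_map r (swap_yz \<sigma> (fst e)) (swap_yz \<sigma> (snd e)) \<in> carrier (tangent_signature s ?I)"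
      by (rule comp[OF e])
    fix e' assume "e' \<in> E"
    have "monom3 (swap_yz \<sigma> (fst e)) \<in> ?I" using std(1)[OF e] by (simp add: std_exps_def)
    then have "arrow_coeff (swap_yz \<sigma> (fst e)) (swap_yz \<sigma> (snd e))
        (arrow_map r (swap_yz \<sigma> (fst e')) (swap_yz \<sigma> (snd e')) :: 'k poly3 \<Rightarrow> _)
        = Poly_Mapping.lookup (Poly_Mapping.single (swap_yz \<sigma> (snd e'))
            (Poly_Mapping.lookup (monom3 (swap_yz \<sigma> (fst e))) (swap_yz \<sigma> (fst e')))) (swap_yz \<sigma> (snd e))"
      using std(2)[OF e] by (simp add: arrow_coeff_def arrow_map_def coset_coeff_coset)
    then show "arrow_coeff (swap_yz \<sigma> (fst e)) (swap_yz \<sigma> (snd e))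
        (arrow_map r (swap_yz \<sigma> (fst e')) (swap_yz \<sigma> (snd e')) :: 'k poly3 \<Rightarrow> _) = (if e = e' then 1 else 0)"
      by (cases e; cases e') (auto simp: monom3_def lookup_single when_def)
  qed
qed

lemma dim_sig_ppn_degree_ge:
  "vectorspace.dim base_field (tangent_signature (sig_ppn \<sigma>) (degree_ge r :: 'k::field poly3 set))
     = (\<Sum>\<gamma>\<in>simplex r. Suc (fst \<gamma>))"
proof (rule antisym)
  interpret monomial_ideal3 "degree_ge r :: 'k poly3 set" by (rule monomial_ideal3_degree_ge)
  have std: "finite (std_exps (degree_ge r :: 'k poly3 set))"
    by (simp add: std_exps_degree_ge finite_simplex)
  show "vectorspace.dim base_field (tangent_signature (sig_ppn \<sigma>) (degree_ge r :: 'k poly3 set))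
      \<le> (\<Sum>\<gamma>\<in>simplex r. Suc (fst \<gamma>))"
    using dim_sig_ppn_le(2)[OF std] by (simp add: std_exps_degree_ge)
  show "(\<Sum>\<gamma>\<in>simplex r. Suc (fst \<gamma>))
      \<le> vectorspace.dim base_field (tangent_signature (sig_ppn \<sigma>) (degree_ge r :: 'k poly3 set))"
    by (rule order.trans[OF card_simplex_arrows_ppn
          card_le_dim_signature_degree_ge[OF dim_sig_ppn_le(1)[OF std], where \<sigma> = \<sigma>]])
       (simp add: has_sig_ppn del: swap_yz.simps)
qed

lemma dim_sig_nnp_degree_ge:
  "vectorspace.dim base_field (tangent_signature (sig_nnp \<sigma>) (degree_ge r :: 'k::field poly3 set))
     = (\<Sum>\<gamma>\<in>simplex r. fst \<gamma>)"
proof (rule antisym)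
  interpret monomial_ideal3 "degree_ge r :: 'k poly3 set" by (rule monomial_ideal3_degree_ge)
  have std: "finite (std_exps (degree_ge r :: 'k poly3 set))"
    by (simp add: std_exps_degree_ge finite_simplex)
  show "vectorspace.dim base_field (tangent_signature (sig_nnp \<sigma>) (degree_ge r :: 'k poly3 set))
      \<le> (\<Sum>\<gamma>\<in>simplex r. fst \<gamma>)"
    using dim_sig_nnp_le(2)[OF std] by (simp add: std_exps_degree_ge)
  show "(\<Sum>\<gamma>\<in>simplex r. fst \<gamma>)
      \<le> vectorspace.dim base_field (tangent_signature (sig_nnp \<sigma>) (degree_ge r :: 'k poly3 set))"
    by (rule order.trans[OF card_simplex_arrows_nnp
          card_le_dim_signature_degree_ge[OF dim_sig_nnp_le(1)[OF std], where \<sigma> = \<sigma>]])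
       (simp add: has_sig_nnp del: swap_yz.simps)
qed

theorem theorem3p6:
  fixes I :: "'k::field_char_0 poly3 set" and r d :: nat
  assumes "d = (r + 2) choose 3"
    and "I \<in> hilb_points d"
    and "borel_fixed I"
  shows "\<forall>s \<in> {(Pos, Pos, Neg), (Pos, Neg, Pos), (Neg, Neg, Pos), (Neg, Pos, Neg)}.
           vectorspace.dim base_field (tangent_signature s I)
             \<le> vectorspace.dim base_field (tangent_signature s (max_ideal_power r))
         \<and> (vectorspace.dim base_field (tangent_signature s I)
              = vectorspace.dim base_field (tangent_signature s (max_ideal_power r))
            \<longleftrightarrow> I = max_ideal_power r)"
proof -
  have ideal: "ideal I poly3_ring" using assms(2) by (simp add: hilb_points_def)
  interpret monomial_ideal3 I by (rule monomial_ideal3_of_borel_fixed[OF ideal assms(3)])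
  let ?B = "std_exps I"
  have B: "finite ?B" "card ?B = card (simplex r)" "borel3 ?B"
    using assms card_std_exps borel3_std_exps[OF ideal assms(3)]
    by (auto simp: hilb_points_def card_simplex)
  note max = sum_fst_borel3[OF B(3,1,2)]
  \<comment> \<open>A monomial ideal is determined by the exponents outside it.\<close>
  have eq: "I = degree_ge r" if "?B = simplex r"
  proof -
    interpret J: monomial_ideal3 "degree_ge r :: 'k poly3 set" by (rule monomial_ideal3_degree_ge)
    have monom: "monom3 \<beta> \<in> I \<longleftrightarrow> monom3 \<beta> \<in> (degree_ge r :: 'k poly3 set)" for \<beta>
      using that std_exps_degree_ge[of r, where 'a = 'k] unfolding std_exps_def by blast
    have "p \<in> I \<longleftrightarrow> p \<in> degree_ge r" for p
      unfolding mem_iff_keys[of p] J.mem_iff_keys[of p] monom ..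
    then show ?thesis by blast
  qed
  \<comment> \<open>Here \<open>n\<close> will be the sum over the exponents outside
    \<open>I\<close>, and \<open>m\<close> the same sum over the simplex, which is the dimension at
    the power of the maximal ideal.\<close>
  have concl: "dI \<le> m \<and> (dI = m \<longleftrightarrow> I = max_ideal_power r)"
    if "dI \<le> n" "n \<le> m" "n = m \<Longrightarrow> ?B = simplex r" "I = max_ideal_power r \<Longrightarrow> dI = m" for dI n m :: nat
    using that eq by (auto simp: max_ideal_power_eq)
  \<comment> \<open>As the cardinality is fixed, the sums for ppn and pnp differ from those for nnp
    and npn by a constant and have the same extremal case.\<close>
  have Suc_eq: "(\<Sum>\<gamma>\<in>A. Suc (fst \<gamma>)) = (\<Sum>\<gamma>\<in>A. fst \<gamma>) + card A" for A :: "(nat \<times> nat \<times> nat) set"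
    by (simp add: sum_Suc)
  have ppn: "vectorspace.dim base_field (tangent_signature (sig_ppn \<sigma>) I) \<le> (\<Sum>\<gamma>\<in>simplex r. Suc (fst \<gamma>))
      \<and> (vectorspace.dim base_field (tangent_signature (sig_ppn \<sigma>) I) = (\<Sum>\<gamma>\<in>simplex r. Suc (fst \<gamma>))
         \<longleftrightarrow> I = max_ideal_power r)" for \<sigma>
    by (rule concl[OF dim_sig_ppn_le(2)[OF B(1)]])
       (use max B(2) in \<open>simp_all add: Suc_eq max_ideal_power_eq dim_sig_ppn_degree_ge\<close>)
  have nnp: "vectorspace.dim base_field (tangent_signature (sig_nnp \<sigma>) I) \<le> (\<Sum>\<gamma>\<in>simplex r. fst \<gamma>)
      \<and> (vectorspace.dim base_field (tangent_signature (sig_nnp \<sigma>) I) = (\<Sum>\<gamma>\<in>simplex r. fst \<gamma>)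
         \<longleftrightarrow> I = max_ideal_power r)" for \<sigma>
    by (rule concl[OF dim_sig_nnp_le(2)[OF B(1)] max])
       (simp_all add: max_ideal_power_eq dim_sig_nnp_degree_ge)
  have "(Pos, Pos, Neg) = sig_ppn False" "(Pos, Neg, Pos) = sig_ppn True"
    "(Neg, Neg, Pos) = sig_nnp False" "(Neg, Pos, Neg) = sig_nnp True"
    by (simp_all add: sig_ppn_def sig_nnp_def)
  \<comment> \<open>Type inference leaves the field of \<^term>\<open>max_ideal_power r\<close> under \<^const>\<open>vectorspace.dim\<close> arbitrary;
    the dimension formulas hold over every field.\<close>
  then show ?thesis
    using ppn nnp by (simp add: max_ideal_power_eq dim_sig_ppn_degree_ge dim_sig_nnp_degree_ge)
qed

end
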